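(* Let $\mathcal{A}$ be a free arrangement in $V=\mathbb{K}^\ell$ with $\exp(\mathcal{A})=(1,d_2,\ldots,d_\ell)$, where $1<d_2\le d_3\le\cdots\le d_\ell$. Let $2\le q\le \ell$ and $H_2,\ldots,H_q\in\mathcal{A}$. Put $\alpha_j:=\alpha_{H_j}$ and $\mathcal{A}_j'':=\mathcal{A}^{H_j}$ for $j=2,\ldots,q$, and $\mathcal{A}':=\mathcal{A}\setminus\{H_2,\ldots,H_q\}$. Assume: (1) $|\mathcal{A}|-|\mathcal{A}_j''|=d_j$ for $j=2,\ldots,q$; (2) $X:=\bigcap_{i=2}^q H_i$ has codimension $q-1$ in $V$; (3) $X\not\subset\bigcup_{K\in\mathcal{A}'}K$. Then $\mathcal{A}'$ is free with exponents $(1,d_2-1,d_3-1,\ldots,d_q-1,d_{q+1},\ldots,d_\ell)$. More explicitly, there is a basis for $D(\mathcal{A})$ of the form $$\theta_E,\ \alpha_2\eta_2,\ \ldots,\ \alpha_q\eta_q,\ \theta_{q+1},\ \ldots,\ \theta_\ell$$ with $\eta_i,\theta_j\in\operatorname{Der}S$ homogeneous, $\deg\eta_i=d_i-1$ for $2\le i\le q$ and $\deg\theta_j=d_j$ for $q+1\le j\le \ell$.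
   Context: $\mathbb{K}$ is an arbitrary field, $V=\mathbb{K}^\ell$, $S=\mathbb{K}[x_1,\ldots,x_\ell]$ its coordinate ring, $\operatorname{Der}S=\bigoplus_{i=1}^\ell S\,\partial_{x_i}$, and $\theta_E=\sum_{i=1}^\ell x_i\partial_{x_i}$ is the Euler derivation. A (hyperplane) arrangement $\mathcal{A}$ in $V$ is a finite set of linear hyperplanes of $V$; for each hyperplane $H$ fix a linear form $\alpha_H\in V^*$ with $\ker\alpha_H=H$. A derivation $\theta\in\operatorname{Der}S$ is homogeneous of degree $d$ if $\theta(\alpha)$ is a homogeneous polynomial of degree $d$ for all $\alpha\in V^*$ with $\theta(\alpha)\ne0$. The logarithmic derivation module is $D(\mathcal{A})=\{\theta\in\operatorname{Der}S\mid \theta(\alpha_H)\in S\alpha_H\ \text{for all }H\in\mathcal{A}\}$. $\mathcal{A}$ is free with exponents $\exp(\mathcal{A})=(d_1,\ldots,d_\ell)$ (a multiset) if $D(\mathcal{A})$ is a free $S$-module with a homogeneous basis $\theta_1,\ldots,\theta_\ell$, $\deg\theta_i=d_i$. For $H\in\mathcal{A}$, $\mathcal{A}^H=\{H\cap L\mid L\in\mathcal{A}\setminus\{H\}\}$, an arrangement in $H$. *)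

theory Defs
  imports
    "HOL-Analysis.Analysis"
    "HOL-Library.Poly_Mapping"
    "HOL-Library.Function_Algebras"
    "HOL-Library.Multiset"
begin

text \<open>
  The ambient space is \<open>V = 'a ^ 'n\<close> over an arbitrary field \<open>'a\<close>, so that the dimension \<open>\<ell>\<close> is
  \<open>CARD('n)\<close>.  Its coordinate ring \<open>S\<close> consists of formal polynomials (not polynomial functions,
  as the field may be finite): a polynomial is a finitely supported function from exponent
  vectors to coefficients.
\<close>

type_synonym ('a, 'n) coord_ring = "('n \<Rightarrow>\<^sub>0 nat) \<Rightarrow>\<^sub>0 'a"

definition const_poly :: "'a::field \<Rightarrow> ('a, 'n::finite) coord_ring" where
  "const_poly c = Poly_Mapping.single 0 c"

definition var :: "'n::finite \<Rightarrow> ('a::field, 'n) coord_ring" where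
  "var i = Poly_Mapping.single (Poly_Mapping.single i 1) 1"

definition homogeneous_poly :: "('a::field, 'n::finite) coord_ring \<Rightarrow> nat \<Rightarrow> bool" where
  "homogeneous_poly p d \<longleftrightarrow>
     (\<forall>m\<in>Poly_Mapping.keys p. (\<Sum>i\<in>UNIV. Poly_Mapping.lookup m i) = d)"

text \<open>
  In the following sum, the truncated subtraction of exponents is harmless: a monomial in which
  the variable does not occur contributes the coefficient 0.
\<close>

definition partial_deriv ::
    "'n::finite \<Rightarrow> ('a::field, 'n) coord_ring \<Rightarrow> ('a, 'n) coord_ring" where
  "partial_deriv i p =
     (\<Sum>m\<in>Poly_Mapping.keys p.
        Poly_Mapping.single (m - Poly_Mapping.single i 1)
          (of_nat (Poly_Mapping.lookup m i) * Poly_Mapping.lookup p m))"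

definition dual_space :: "('a::field ^ 'n::finite \<Rightarrow> 'a) set" where
  "dual_space = {\<alpha>. Vector_Spaces.linear (*s) (*) \<alpha>}"

definition ker :: "('a::field ^ 'n::finite \<Rightarrow> 'a) \<Rightarrow> ('a ^ 'n) set" where
  "ker \<alpha> = {v. \<alpha> v = 0}"

text \<open>The inclusion of the dual space of \<open>V\<close> into \<open>S\<close>.\<close>

definition form_poly :: "('a::field ^ 'n::finite \<Rightarrow> 'a) \<Rightarrow> ('a, 'n) coord_ring" where
  "form_poly \<alpha> = (\<Sum>i\<in>UNIV. const_poly (\<alpha> (axis i 1)) * var i)"

text \<open>
  Derivations are represented as operators on \<open>S\<close>.  Addition of operators is pointwise
  (from \<open>Function_Algebras\<close>), and \<open>S\<close> acts on them by multiplication of the values.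
\<close>

type_synonym ('a, 'n) operator = "('a, 'n) coord_ring \<Rightarrow> ('a, 'n) coord_ring"

definition op_scale ::
    "('a::field, 'n::finite) coord_ring \<Rightarrow> ('a, 'n) operator \<Rightarrow> ('a, 'n) operator"
    (infixr \<open>*\<^sub>S\<close> 75) where
  "f *\<^sub>S \<theta> = (\<lambda>p. f * \<theta> p)"

interpretation op: module "op_scale :: ('a::field, 'n::finite) coord_ring \<Rightarrow> _"
  by unfold_locales (auto simp: op_scale_def fun_eq_iff algebra_simps)

definition Der :: "('a::field, 'n::finite) operator set" where
  "Der = op.span (range partial_deriv)"

definition euler :: "('a::field, 'n::finite) operator" where
  "euler = (\<Sum>i\<in>UNIV. var i *\<^sub>S partial_deriv i)"

definition homogeneous_der :: "('a::field, 'n::finite) operator \<Rightarrow> nat \<Rightarrow> bool" where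
  "homogeneous_der \<theta> d \<longleftrightarrow>
     (\<forall>\<alpha>\<in>dual_space. \<theta> (form_poly \<alpha>) \<noteq> 0 \<longrightarrow> homogeneous_poly (\<theta> (form_poly \<alpha>)) d)"

definition codim :: "('a::field ^ 'n::finite) set \<Rightarrow> nat" where
  "codim U = CARD('n) - vec.dim U"

definition arrangement :: "('a::field ^ 'n::finite) set set \<Rightarrow> bool" where
  "arrangement \<A> \<longleftrightarrow> finite \<A> \<and> (\<forall>H\<in>\<A>. vec.subspace H \<and> codim H = 1)"

definition restriction :: "('a::field ^ 'n::finite) set set \<Rightarrow> ('a ^ 'n) set \<Rightarrow> ('a ^ 'n) set set" where
  "restriction \<A> H = {H \<inter> L | L. L \<in> \<A> - {H}}"

definition defining_forms ::
    "('a::field ^ 'n::finite) set set \<Rightarrow> (('a ^ 'n) set \<Rightarrow> 'a ^ 'n \<Rightarrow> 'a) \<Rightarrow> bool" where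
  "defining_forms \<A> \<alpha> \<longleftrightarrow> (\<forall>H\<in>\<A>. \<alpha> H \<in> dual_space \<and> ker (\<alpha> H) = H)"

definition log_der ::
    "(('a::field ^ 'n::finite) set \<Rightarrow> 'a ^ 'n \<Rightarrow> 'a) \<Rightarrow> ('a ^ 'n) set set \<Rightarrow> ('a, 'n) operator set" where
  "log_der \<alpha> \<A> = {\<theta> \<in> Der. \<forall>H\<in>\<A>. form_poly (\<alpha> H) dvd \<theta> (form_poly (\<alpha> H))}"

definition basis_family ::
    "'i set \<Rightarrow> ('i \<Rightarrow> ('a::field, 'n::finite) operator) \<Rightarrow> ('a, 'n) operator set \<Rightarrow> bool" where
  "basis_family I \<theta> M \<longleftrightarrow> inj_on \<theta> I \<and> op.independent (\<theta> ` I) \<and> op.span (\<theta> ` I) = M"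

definition free_with_exponents ::
    "(('a::field ^ 'n::finite) set \<Rightarrow> 'a ^ 'n \<Rightarrow> 'a) \<Rightarrow> ('a ^ 'n) set set \<Rightarrow> nat multiset \<Rightarrow> bool" where
  "free_with_exponents \<alpha> \<A> E \<longleftrightarrow>
     (\<exists>(\<theta> :: nat \<Rightarrow> ('a, 'n) operator) e.
        basis_family {1..CARD('n)} \<theta> (log_der \<alpha> \<A>) \<and>
        (\<forall>i\<in>{1..CARD('n)}. homogeneous_der (\<theta> i) (e i)) \<and>
        E = image_mset e (mset_set {1..CARD('n)}))"

end

theory Submission
  imports Defs "HOL-Combinatorics.Permutations"
begin

text \<open>
  Identify derivations with their coefficient vectors, and let \<open>M\<close> be the matrix of a homogeneous basis
  of \<open>D(\<A>)\<close>, so that \<open>det M = c Q\<close> with \<open>Q\<close> the product of the defining forms (Saito).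
  Modulo \<open>\<alpha>\<^sub>j\<close> the rows of \<open>M\<close> satisfy a relation whose coefficients are the maximal minors, and all of
  these are divisible by the product of the forms of \<open>\<A>\<^sub>j''\<close>. Removing this factor gives coefficients
  \<open>g\<^sub>j\<^sub>i\<close> of degree \<open>|\<A>| - |\<A>\<^sub>j''| - d\<^sub>i = d\<^sub>j - d\<^sub>i\<close> with \<open>\<Sum>\<^sub>i g\<^sub>j\<^sub>i \<theta>\<^sub>i = \<alpha>\<^sub>j \<eta>\<^sub>j\<close>.
  At a point \<open>x\<close> of \<open>X\<close> outside the hyperplanes of \<open>\<A>'\<close> one finds \<open>\<eta>\<^sub>j(\<alpha>\<^sub>j)(x) \<noteq> 0\<close>, which makes the
  vectors \<open>g\<^sub>j(x)\<close> and the unit vector of \<open>\<theta>\<^sub>E\<close> linearly independent. Completed by unit vectors they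
  form an invertible matrix; the polynomial matrix behind it has a homogeneous determinant of degree at
  most 0, because \<open>d\<^sub>2, \<dots>, d\<^sub>q\<close> are the smallest exponents, so this determinant is a nonzero constant
  and \<open>\<theta>\<^sub>E, \<alpha>\<^sub>j \<eta>\<^sub>j\<close> and the remaining \<open>\<theta>\<^sub>i\<close> form a basis of \<open>D(\<A>)\<close>. Dividing the rows by the \<open>\<alpha>\<^sub>j\<close>
  divides the determinant by their product, and Saito's criterion applies to \<open>\<A>'\<close>.
\<close>

subsection \<open>Substitution homomorphisms\<close>

lemma poly_mapping_eq_sum_single:
  "p = (\<Sum>m\<in>Poly_Mapping.keys p. Poly_Mapping.single m (Poly_Mapping.lookup p m))"
proof (rule poly_mapping_eqI)
  fix k
  show "Poly_Mapping.lookup p k =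
    Poly_Mapping.lookup (\<Sum>m\<in>Poly_Mapping.keys p. Poly_Mapping.single m (Poly_Mapping.lookup p m)) k"
    by (auto simp: lookup_sum lookup_single when_def in_keys_iff)
qed

text \<open>One construction covers three homomorphisms: renaming variables into another polynomial
  ring, substituting polynomials inside \<open>S\<close>, and evaluating at a point.\<close>

definition insertion ::
    "('a::field \<Rightarrow> 'b::comm_ring_1) \<Rightarrow> ('n::finite \<Rightarrow> 'b) \<Rightarrow> ('a, 'n) coord_ring \<Rightarrow> 'b" where
  "insertion h y p =
     (\<Sum>m\<in>Poly_Mapping.keys p. h (Poly_Mapping.lookup p m) * (\<Prod>i\<in>UNIV. y i ^ Poly_Mapping.lookup m i))"

locale coeff_hom =
  fixes h :: "'a::field \<Rightarrow> 'b::comm_ring_1"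
  assumes hom_zero: "h 0 = 0" and hom_one: "h 1 = 1"
    and hom_add: "h (a + b) = h a + h b" and hom_mult: "h (a * b) = h a * h b"
begin

lemma insertion_superset:
  assumes "finite A" "Poly_Mapping.keys p \<subseteq> A"
  shows "insertion h y p =
    (\<Sum>m\<in>A. h (Poly_Mapping.lookup p m) * (\<Prod>i\<in>UNIV. y i ^ Poly_Mapping.lookup m i))"
  unfolding insertion_def
  by (rule sum.mono_neutral_left) (use assms in \<open>auto simp: in_keys_iff hom_zero\<close>)

lemma insertion_add: "insertion h y (p + q) = insertion h y p + insertion h y q"
proof -
  let ?A = "Poly_Mapping.keys p \<union> Poly_Mapping.keys q"
  have "finite ?A" by simp
  then show ?thesis
    by (subst (1 2 3) insertion_superset[of ?A])
      (auto simp: lookup_add hom_add algebra_simps sum.distrib dest: subsetD[OF Poly_Mapping.keys_add])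
qed

lemma insertion_zero [simp]: "insertion h y 0 = 0"
  by (simp add: insertion_def)

lemma insertion_uminus: "insertion h y (- p) = - insertion h y p"
  by (metis add.right_inverse add_eq_0_iff insertion_add insertion_zero)

lemma insertion_diff: "insertion h y (p - q) = insertion h y p - insertion h y q"
  using insertion_add[of y p "- q"] by (simp add: insertion_uminus)

lemma insertion_sum: "insertion h y (sum f A) = (\<Sum>a\<in>A. insertion h y (f a))"
  by (induction A rule: infinite_finite_induct) (auto simp: insertion_add)

lemma insertion_single:
  "insertion h y (Poly_Mapping.single m c) = h c * (\<Prod>i\<in>UNIV. y i ^ Poly_Mapping.lookup m i)"
  by (subst insertion_superset[of "{m}"]) auto

lemma insertion_const [simp]: "insertion h y (const_poly c) = h c"
  by (simp add: const_poly_def insertion_single)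

lemma insertion_var [simp]: "insertion h y (var i) = y i"
proof -
  have "(\<Prod>j\<in>UNIV. y j ^ Poly_Mapping.lookup (Poly_Mapping.single i (1::nat)) j)
      = (\<Prod>j\<in>UNIV. if j = i then y i else 1)"
    by (rule prod.cong) (auto simp: lookup_single when_def)
  then show ?thesis by (simp add: var_def insertion_single hom_one)
qed

lemma insertion_one [simp]: "insertion h y 1 = 1"
  using insertion_single[of y 0 1] by (simp add: hom_one)

lemma insertion_mult: "insertion h y (p * q) = insertion h y p * insertion h y q"
proof -
  have single: "insertion h y (Poly_Mapping.single m a * Poly_Mapping.single n b) =
      insertion h y (Poly_Mapping.single m a) * insertion h y (Poly_Mapping.single n b)" for m n a b
    by (simp add: mult_single insertion_single hom_mult lookup_add power_add prod.distrib algebra_simps)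
  have "insertion h y (p * q) = insertion h y
     ((\<Sum>m\<in>Poly_Mapping.keys p. Poly_Mapping.single m (Poly_Mapping.lookup p m)) *
      (\<Sum>m\<in>Poly_Mapping.keys q. Poly_Mapping.single m (Poly_Mapping.lookup q m)))"
    by (simp flip: poly_mapping_eq_sum_single)
  also have "\<dots> =
     insertion h y (\<Sum>m\<in>Poly_Mapping.keys p. Poly_Mapping.single m (Poly_Mapping.lookup p m)) *
     insertion h y (\<Sum>m\<in>Poly_Mapping.keys q. Poly_Mapping.single m (Poly_Mapping.lookup q m))"
    by (simp add: sum_product insertion_sum single)
  finally show ?thesis by (simp flip: poly_mapping_eq_sum_single)
qed

lemma insertion_prod: "insertion h y (prod f A) = (\<Prod>a\<in>A. insertion h y (f a))"
  by (induction A rule: infinite_finite_induct) (auto simp: insertion_mult)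

lemma insertion_of_int [simp]: "insertion h y (of_int k) = of_int k"
proof -
  have "insertion h y (of_nat n) = of_nat n" for n
    by (induction n) (auto simp: insertion_add)
  then show ?thesis
    by (cases k rule: int_cases2) (auto simp: insertion_uminus)
qed

lemma insertion_dvd: "p dvd q \<Longrightarrow> insertion h y p dvd insertion h y q"
  by (auto simp: insertion_mult elim!: dvdE)

lemma insertion_det: "insertion h y (det A) = det (\<chi> i j. insertion h y (A $ i $ j))"
  by (simp add: det_def insertion_sum insertion_mult insertion_prod)

end

lemma const_poly_0 [simp]: "const_poly 0 = 0"
  and const_poly_1 [simp]: "const_poly 1 = 1"
  and const_poly_add: "const_poly (a + b) = const_poly a + const_poly b"
  and const_poly_diff: "const_poly (a - b) = const_poly a - const_poly b"
  and const_poly_mult: "const_poly (a * b) = const_poly a * const_poly b"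
  by (simp_all add: const_poly_def single_add single_diff mult_single)

lemma const_poly_eq_iff [simp]: "const_poly a = const_poly b \<longleftrightarrow> a = b"
  by (simp add: const_poly_def inj_eq)

lemma const_poly_eq_0_iff [simp]: "const_poly a = 0 \<longleftrightarrow> a = 0"
  by (metis const_poly_0 const_poly_eq_iff)

lemma const_poly_sum: "const_poly (sum f A) = (\<Sum>a\<in>A. const_poly (f a))"
  by (induction A rule: infinite_finite_induct) (auto simp: const_poly_add)

lemma const_poly_inverse: "a \<noteq> 0 \<Longrightarrow> const_poly a * const_poly (inverse a) = 1"
  by (simp flip: const_poly_mult)

interpretation subst: coeff_hom "const_poly :: 'a::field \<Rightarrow> ('a, 'n::finite) coord_ring"
  by unfold_locales (auto simp: const_poly_add const_poly_mult)

interpretation ev: coeff_hom "\<lambda>c::'a::field. c"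
  by unfold_locales auto

text \<open>Constants and variables generate \<open>S\<close> as a ring, since every monomial is a
  constant times a product of powers of variables.\<close>

lemma coord_ring_induct [case_names const var add mult]:
  fixes p :: "('a::field, 'n::finite) coord_ring"
  assumes const: "\<And>c. P (const_poly c)" and var: "\<And>i. P (var i)"
    and add: "\<And>p q. P p \<Longrightarrow> P q \<Longrightarrow> P (p + q)" and mult: "\<And>p q. P p \<Longrightarrow> P q \<Longrightarrow> P (p * q)"
  shows "P p"
proof -
  have one: "P 1" using const[of 1] by simp
  have zero: "P 0" using const[of 0] by simp
  have power: "P (var i ^ k)" for i and k :: nat
    by (induction k) (auto intro: one var mult)
  have prod: "P (\<Prod>i\<in>I. f i)" if "finite I" "\<And>i. P (f i)" for I :: "'n set" and f
    using that by (induction I rule: finite_induct) (auto intro: one mult)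
  have sum: "P (\<Sum>i\<in>I. f i)" if "finite I" "\<And>i. P (f i)"
    for I :: "('n \<Rightarrow>\<^sub>0 nat) set" and f
    using that by (induction I rule: finite_induct) (auto intro: zero add)
  have pow: "var i ^ k = Poly_Mapping.single (Poly_Mapping.single i k) (1::'a)" for i :: 'n and k
    by (induction k) (auto simp: var_def mult_single simp flip: single_add)
  have prod_single: "(\<Prod>i\<in>I. Poly_Mapping.single (f i) (1::'a)) = Poly_Mapping.single (\<Sum>i\<in>I. f i) 1"
    if "finite I" for I :: "'n set" and f :: "'n \<Rightarrow> ('n \<Rightarrow>\<^sub>0 nat)"
    using that by (induction I rule: finite_induct) (auto simp: mult_single)
  have exponent: "(\<Sum>i\<in>UNIV. Poly_Mapping.single i (Poly_Mapping.lookup m i)) = m" for m :: "'n \<Rightarrow>\<^sub>0 nat"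
    by (rule poly_mapping_eqI) (simp add: lookup_sum lookup_single when_def)
  have "Poly_Mapping.single m c = const_poly c * (\<Prod>i\<in>UNIV. var i ^ Poly_Mapping.lookup m i)"
    for m :: "'n \<Rightarrow>\<^sub>0 nat" and c :: 'a
    by (simp add: pow prod_single exponent const_poly_def mult_single)
  then have single: "P (Poly_Mapping.single m c)" for m c
    by (auto intro!: mult const prod power)
  show ?thesis
    by (subst poly_mapping_eq_sum_single) (auto intro!: sum single)
qed

subsection \<open>The coordinate ring is a domain\<close>

text \<open>The library knows that polynomials form a domain only for a linearly ordered set of variables.\<close>

lemma coord_ring_no_zero_divisors:
  fixes p q :: "('a::field, 'n::finite) coord_ring"
  assumes "p * q = 0" shows "p = 0 \<or> q = 0"
proof -
  \<comment> \<open>An injective numbering of the variables embeds \<open>S\<close> into the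
    polynomials over variables indexed by natural numbers, a domain; \<open>\<mu>\<close> is the
    induced injection on exponent vectors.\<close>
  obtain \<iota> :: "'n \<Rightarrow> nat" where \<iota>: "inj \<iota>"
    using finite_imp_inj_to_nat_seg[of "UNIV :: 'n set"] by auto
  let ?h = "Poly_Mapping.single 0 :: 'a \<Rightarrow> (nat \<Rightarrow>\<^sub>0 nat) \<Rightarrow>\<^sub>0 'a"
  let ?y = "\<lambda>i. Poly_Mapping.single (Poly_Mapping.single (\<iota> i) (1::nat)) (1::'a)"
  interpret coeff_hom ?h
    by unfold_locales (auto simp: single_add mult_single)
  define \<mu> :: "('n \<Rightarrow>\<^sub>0 nat) \<Rightarrow> (nat \<Rightarrow>\<^sub>0 nat)" where
    "\<mu> m = (\<Sum>i\<in>UNIV. Poly_Mapping.single (\<iota> i) (Poly_Mapping.lookup m i))" for m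
  have \<mu>: "Poly_Mapping.lookup (\<mu> m) (\<iota> i) = Poly_Mapping.lookup m i" for m i
    by (simp add: \<mu>_def lookup_sum lookup_single when_def inj_eq[OF \<iota>])
  have \<mu>_inj: "\<mu> m = \<mu> m' \<longleftrightarrow> m = m'" for m m'
    by (metis \<mu> poly_mapping_eqI)
  have pow: "?y i ^ k = Poly_Mapping.single (Poly_Mapping.single (\<iota> i) k) 1" for i k
    by (induction k) (auto simp: mult_single simp flip: single_add)
  have prod_single: "(\<Prod>i\<in>I. Poly_Mapping.single (f i) (1::'a)) = Poly_Mapping.single (\<Sum>i\<in>I. f i) 1"
    if "finite I" for I :: "'n set" and f :: "'n \<Rightarrow> (nat \<Rightarrow>\<^sub>0 nat)"
    using that by (induction I rule: finite_induct) (auto simp: mult_single)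
  have expand: "insertion ?h ?y r =
      (\<Sum>m\<in>Poly_Mapping.keys r. Poly_Mapping.single (\<mu> m) (Poly_Mapping.lookup r m))" for r
    by (simp add: insertion_def pow prod_single mult_single \<mu>_def del: One_nat_def)
  have inj: "r = 0" if "insertion ?h ?y r = 0" for r
  proof (rule poly_mapping_eqI)
    fix m
    have "Poly_Mapping.lookup (insertion ?h ?y r) (\<mu> m) = Poly_Mapping.lookup r m"
      unfolding expand by (simp add: lookup_sum lookup_single when_def \<mu>_inj in_keys_iff)
    then show "Poly_Mapping.lookup r m = Poly_Mapping.lookup 0 m" using that by simp
  qed
  have "insertion ?h ?y p * insertion ?h ?y q = 0"
    using insertion_mult[of ?y p q] assms by simp
  then show ?thesis using inj by auto
qed

lemma coord_ring_mult_eq_0_iff: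
  fixes p q :: "('a::field, 'n::finite) coord_ring"
  shows "p * q = 0 \<longleftrightarrow> p = 0 \<or> q = 0"
  using coord_ring_no_zero_divisors by auto

lemma coord_ring_mult_left_cancel:
  fixes p q r :: "('a::field, 'n::finite) coord_ring"
  assumes "r * p = r * q" "r \<noteq> 0" shows "p = q"
  using coord_ring_no_zero_divisors[of r "p - q"] assms by (simp add: algebra_simps)

lemma coord_ring_dvd_mult_left_cancel:
  fixes p q r :: "('a::field, 'n::finite) coord_ring"
  assumes "r * p dvd r * q" "r \<noteq> 0" shows "p dvd q"
proof -
  from assms(1) obtain s where "r * q = r * p * s" by (rule dvdE)
  then have "q = p * s" using assms(2) by (metis coord_ring_mult_left_cancel mult.assoc)
  then show ?thesis by simp
qed

lemma coord_ring_prod_eq_0_iff: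
  fixes f :: "'c \<Rightarrow> ('a::field, 'n::finite) coord_ring"
  assumes "finite A" shows "prod f A = 0 \<longleftrightarrow> (\<exists>a\<in>A. f a = 0)"
  using assms by (induction A rule: finite_induct) (auto simp: coord_ring_mult_eq_0_iff)

text \<open>When a new prime \<open>f c\<close> is split off, it divides \<open>prod f C * g\<close>
  but no factor of \<open>prod f C\<close>, hence it divides \<open>g\<close>.\<close>

lemma prod_primes_dvd:
  fixes f :: "'c \<Rightarrow> ('a::field, 'n::finite) coord_ring"
  assumes "finite C" "\<And>c. c \<in> C \<Longrightarrow> prime_elem (f c)" "\<And>c. c \<in> C \<Longrightarrow> f c dvd p"
    and "\<And>b c. b \<in> C \<Longrightarrow> c \<in> C \<Longrightarrow> b \<noteq> c \<Longrightarrow> \<not> f b dvd f c"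
  shows "prod f C dvd p"
  using assms
proof (induction C rule: finite_induct)
  case (insert c C)
  then have "prod f C dvd p" by auto
  then obtain g where g: "p = prod f C * g" by (rule dvdE)
  have "\<not> f c dvd prod f B" if "finite B" "B \<subseteq> C" for B
    using that
    by (induction B rule: finite_induct)
      (use insert.prems(1,3) insert.hyps(2) in
        \<open>auto dest!: prime_elem_not_unit prime_elem_dvd_multD[rotated]\<close>)
  then have "\<not> f c dvd prod f C" using insert.hyps by auto
  moreover have "f c dvd prod f C * g" using insert.prems(2)[of c] g by simp
  ultimately have "f c dvd g" using insert.prems(1) by (metis insertI1 prime_elem_dvd_multD)
  then show ?case using g insert.hyps by (auto simp: mult.commute mult_dvd_mono)
qed simp

lemma prime_dvd_prodD:
  assumes "finite C" "prime_elem p" "p dvd prod f C"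
  shows "\<exists>c\<in>C. p dvd f c"
  using assms
proof (induction C rule: finite_induct)
  case empty
  then show ?case using prime_elem_not_unit by auto
next
  case (insert c C)
  from insert.hyps insert.prems have "p dvd f c * prod f C" by simp
  with insert.prems(1) have "p dvd f c \<or> p dvd prod f C" by (rule prime_elem_dvd_multD)
  then show ?case using insert.IH[OF insert.prems(1)] by auto
qed

text \<open>As \<open>f c\<close> does not divide \<open>p\<close>, it divides the cofactor of
  \<open>p\<close> and cancels. Doing this for every factor of the power leaves
  \<open>p dvd 1\<close>.\<close>

lemma dvd_prod_primes_imp_unit:
  fixes f :: "'c \<Rightarrow> ('a::field, 'n::finite) coord_ring"
  assumes "finite C" "\<And>c. c \<in> C \<Longrightarrow> prime_elem (f c)" "\<And>c. c \<in> C \<Longrightarrow> \<not> f c dvd p"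
    "p dvd prod f C ^ k"
  shows "p dvd 1"
proof -
  have step: "p dvd g" if "p dvd prod f B * g" "finite B" "B \<subseteq> C" for B g
    using that(2,3,1)
  proof (induction B arbitrary: g rule: finite_induct)
    case (insert c B)
    from insert.prems(2) have "p dvd f c * (prod f B * g)"
      by (simp add: insert.hyps mult.assoc)
    then obtain r where r: "f c * (prod f B * g) = p * r" by (rule dvdE)
    then have "f c dvd p * r" by (rule dvdI[OF sym])
    moreover have "c \<in> C" using insert.prems by simp
    ultimately have "f c dvd r" using assms(2,3) prime_elem_dvd_multD by blast
    then obtain t where "r = f c * t" by (rule dvdE)
    then have "f c * (prod f B * g) = f c * (p * t)" using r by (simp add: algebra_simps)
    moreover have "f c \<noteq> 0" using assms(2)[OF \<open>c \<in> C\<close>] by (simp add: prime_elem_def)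
    ultimately have "prod f B * g = p * t" by (metis coord_ring_mult_left_cancel)
    then have "p dvd prod f B * g" by simp
    then show ?case by (rule insert.IH[rotated]) (use insert.prems(1) in simp)
  qed simp
  show ?thesis
    using assms(4)
  proof (induction k)
    case (Suc k)
    then have "p dvd prod f C * prod f C ^ k" by simp
    then have "p dvd prod f C ^ k" using step[of C] assms(1) by blast
    then show ?case by (rule Suc.IH)
  qed simp
qed

subsection \<open>Homogeneous polynomials\<close>

text \<open>Integer degrees let degrees be subtracted freely: only 0 has negative degree.\<close>

definition hdeg :: "('a::field, 'n::finite) coord_ring \<Rightarrow> int \<Rightarrow> bool" where
  "hdeg p z \<longleftrightarrow> (\<forall>m\<in>Poly_Mapping.keys p. int (\<Sum>i\<in>UNIV. Poly_Mapping.lookup m i) = z)"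

lemma homogeneous_poly_iff_hdeg: "homogeneous_poly p d \<longleftrightarrow> hdeg p (int d)"
  by (simp add: homogeneous_poly_def hdeg_def del: of_nat_sum)

lemma hdeg_zero [simp]: "hdeg 0 z"
  by (simp add: hdeg_def)

lemma hdeg_add: "hdeg p z \<Longrightarrow> hdeg q z \<Longrightarrow> hdeg (p + q) z"
  using Poly_Mapping.keys_add[of p q] by (auto simp: hdeg_def)

lemma hdeg_sum: "(\<And>a. a \<in> A \<Longrightarrow> hdeg (f a) z) \<Longrightarrow> hdeg (sum f A) z"
  by (induction A rule: infinite_finite_induct) (auto intro: hdeg_add)

lemma hdeg_mult:
  assumes "hdeg p z" "hdeg q w" shows "hdeg (p * q) (z + w)"
  unfolding hdeg_def
proof
  fix m assume "m \<in> Poly_Mapping.keys (p * q)"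
  then obtain a b where "a \<in> Poly_Mapping.keys p" "b \<in> Poly_Mapping.keys q" "m = a + b"
    using keys_mult[of p q] by auto
  then show "int (\<Sum>i\<in>UNIV. Poly_Mapping.lookup m i) = z + w"
    using assms by (auto simp: hdeg_def lookup_add sum.distrib)
qed

lemma hdeg_const [simp]: "hdeg (const_poly c) 0"
  by (simp add: hdeg_def const_poly_def)

lemma hdeg_one [simp]: "hdeg 1 0"
  by (simp add: hdeg_def)

lemma hdeg_const_mult: "hdeg p z \<Longrightarrow> hdeg (const_poly c * p) z"
  using hdeg_mult[of "const_poly c" 0 p z] by simp

lemma hdeg_var [simp]: "hdeg (var i) 1"
  by (simp add: hdeg_def var_def lookup_single when_def)

lemma hdeg_diff: "hdeg p z \<Longrightarrow> hdeg q z \<Longrightarrow> hdeg (p - q) z"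
proof -
  assume "hdeg p z" "hdeg q z"
  then have "hdeg (p + const_poly (-1) * q) z" by (intro hdeg_add hdeg_const_mult)
  moreover have "const_poly (-1) * q = - q"
    by (simp add: const_poly_def single_uminus)
  ultimately show ?thesis by simp
qed

lemma hdeg_prod: "(\<And>a. a \<in> A \<Longrightarrow> hdeg (f a) (w a)) \<Longrightarrow> hdeg (prod f A) (sum w A)"
  by (induction A rule: infinite_finite_induct) (auto intro: hdeg_mult)

lemma hdeg_of_int: "hdeg (of_int k) 0"
proof -
  have "of_int k = const_poly (of_int k)"
    by (simp add: const_poly_def)
  then show ?thesis by (metis hdeg_const)
qed

lemma hdeg_insertion:
  assumes "hdeg p z" "\<And>i. hdeg (y i) 1"
  shows "hdeg (insertion const_poly y p) z"
  unfolding insertion_def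
proof (rule hdeg_sum, rule hdeg_const_mult)
  fix m assume "m \<in> Poly_Mapping.keys p"
  then have z: "z = (\<Sum>i\<in>UNIV. int (Poly_Mapping.lookup m i))"
    using assms(1) by (simp add: hdeg_def)
  have pow: "hdeg (y i ^ k) (int k)" for i k
    by (induction k) (use hdeg_mult[OF assms(2)] in auto)
  show "hdeg (\<Prod>i\<in>UNIV. y i ^ Poly_Mapping.lookup m i) z"
    unfolding z by (rule hdeg_prod) (rule pow)
qed

lemma hdeg_nonneg: "hdeg p z \<Longrightarrow> p \<noteq> 0 \<Longrightarrow> z \<ge> 0"
  unfolding hdeg_def by (metis equals0I keys_eq_empty of_nat_0_le_iff)

lemma hdeg_0_imp_const:
  assumes "hdeg p 0" shows "p = const_poly (Poly_Mapping.lookup p 0)"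
proof (rule poly_mapping_eqI)
  fix m
  show "Poly_Mapping.lookup p m = Poly_Mapping.lookup (const_poly (Poly_Mapping.lookup p 0)) m"
  proof (cases "m = 0")
    case False
    then obtain i where "Poly_Mapping.lookup m i \<noteq> 0" by (metis lookup_zero poly_mapping_eqI)
    then have "(\<Sum>i\<in>UNIV. Poly_Mapping.lookup m i) \<noteq> 0" by auto
    then have "m \<notin> Poly_Mapping.keys p" using assms by (auto simp: hdeg_def simp del: of_nat_sum)
    then show ?thesis using False by (simp add: const_poly_def lookup_single in_keys_iff)
  qed (simp add: const_poly_def)
qed

text \<open>The homogeneous component of degree \<open>z\<close>; the integer index allows negative
  degrees, where it is 0.\<close>

definition hcomp :: "int \<Rightarrow> ('a::field, 'n::finite) coord_ring \<Rightarrow> ('a, 'n) coord_ring" where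
  "hcomp z p = (\<Sum>m \<in> {m \<in> Poly_Mapping.keys p. int (\<Sum>i\<in>UNIV. Poly_Mapping.lookup m i) = z}.
     Poly_Mapping.single m (Poly_Mapping.lookup p m))"

lemma lookup_hcomp:
  "Poly_Mapping.lookup (hcomp z p) m =
    (if int (\<Sum>i\<in>UNIV. Poly_Mapping.lookup m i) = z then Poly_Mapping.lookup p m else 0)"
  by (auto simp: hcomp_def lookup_sum lookup_single when_def in_keys_iff sum.delta' simp del: of_nat_sum)

lemma hdeg_hcomp: "hdeg (hcomp z p) z"
  by (auto simp: hdeg_def in_keys_iff lookup_hcomp simp del: of_nat_sum split: if_splits)

lemma hcomp_add: "hcomp z (p + q) = hcomp z p + hcomp z q"
  by (rule poly_mapping_eqI) (simp add: lookup_hcomp lookup_add)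

lemma hcomp_sum: "hcomp z (sum f A) = (\<Sum>a\<in>A. hcomp z (f a))"
  by (induction A rule: infinite_finite_induct) (auto simp: hcomp_add, auto simp: hcomp_def)

lemma hcomp_eq_self: "hdeg p z \<Longrightarrow> hcomp z p = p"
  by (rule poly_mapping_eqI) (auto simp: lookup_hcomp hdeg_def in_keys_iff simp del: of_nat_sum)

text \<open>Multiplication by \<open>p\<close> shifts every degree by \<open>w\<close>, so the
  components of \<open>q\<close> outside degree \<open>z\<close> contribute nothing in degree
  \<open>z + w\<close>.\<close>

lemma hcomp_mult:
  assumes "hdeg p w" shows "hcomp (z + w) (p * q) = p * hcomp z q"
proof -
  define r where "r = q - hcomp z q"
  have "hcomp (z + w) (p * r) = 0"
  proof (rule poly_mapping_eqI)
    fix m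
    have "m \<notin> Poly_Mapping.keys (p * r)" if m: "int (\<Sum>i\<in>UNIV. Poly_Mapping.lookup m i) = z + w"
    proof
      assume "m \<in> Poly_Mapping.keys (p * r)"
      then obtain a b where ab: "a \<in> Poly_Mapping.keys p" "b \<in> Poly_Mapping.keys r" "m = a + b"
        using keys_mult[of p r] by auto
      then have "int (\<Sum>i\<in>UNIV. Poly_Mapping.lookup b i) = z"
        using assms m by (auto simp: hdeg_def lookup_add sum.distrib)
      then show False
        using ab(2) by (simp add: r_def in_keys_iff lookup_minus lookup_hcomp del: of_nat_sum)
    qed
    then show "Poly_Mapping.lookup (hcomp (z + w) (p * r)) m = Poly_Mapping.lookup 0 m"
      by (simp add: lookup_hcomp in_keys_iff del: of_nat_sum)
  qed
  moreover have "p * q = p * r + p * hcomp z q" by (simp add: r_def algebra_simps)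
  moreover have "hdeg (p * hcomp z q) (z + w)"
    using hdeg_mult[OF assms hdeg_hcomp[of z q]] by (simp add: add.commute)
  ultimately show ?thesis by (simp add: hcomp_add hcomp_eq_self)
qed

text \<open>Comparing the components of degree \<open>z\<close> gives
  \<open>p * hcomp (z - w) q = p * q\<close>, and \<open>p\<close> cancels.\<close>

lemma hdeg_mult_cancel:
  assumes "hdeg (p * q) z" "hdeg p w" "p \<noteq> 0" shows "hdeg q (z - w)"
proof -
  have "p * hcomp (z - w) q = p * q"
    using hcomp_mult[OF assms(2), of "z - w" q] hcomp_eq_self[OF assms(1)] by simp
  then show ?thesis using assms(3) hdeg_hcomp coord_ring_mult_left_cancel by metis
qed

subsection \<open>Linear forms\<close>

definition cdot :: "'a::field ^ 'n::finite \<Rightarrow> 'a ^ 'n \<Rightarrow> 'a" where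
  "cdot a v = (\<Sum>i\<in>UNIV. a $ i * v $ i)"

lemma cdot_add: "cdot (a + b) v = cdot a v + cdot b v"
  and cdot_diff: "cdot (a - b) v = cdot a v - cdot b v"
  and cdot_scale: "cdot (c *s a) v = c * cdot a v"
  by (simp_all add: cdot_def algebra_simps sum.distrib sum_subtractf sum_distrib_left)

lemma cdot_axis [simp]: "cdot a (axis k c) = a $ k * c"
  by (simp add: cdot_def axis_def if_distrib[of "\<lambda>t. _ * t"] cong: if_cong)

lemma cdot_eq_1_obtain:
  assumes "a \<noteq> 0" obtains k where "a $ k \<noteq> 0" "cdot a (axis k (inverse (a $ k))) = 1"
proof -
  from assms obtain k where "a $ k \<noteq> 0" by (auto simp: vec_eq_iff)
  then show thesis using that by simp
qed

definition lin :: "'a::field ^ 'n::finite \<Rightarrow> ('a, 'n) coord_ring" where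
  "lin a = (\<Sum>i\<in>UNIV. const_poly (a $ i) * var i)"

lemma hdeg_lin [simp]: "hdeg (lin a) 1"
  unfolding lin_def by (intro hdeg_sum hdeg_const_mult hdeg_var)

lemma lin_diff: "lin (a - b) = lin a - lin b"
  and lin_scale: "lin (c *s a) = const_poly c * lin a"
  by (simp_all add: lin_def const_poly_diff const_poly_mult algebra_simps sum_subtractf sum_distrib_left)

lemma lookup_lin: "Poly_Mapping.lookup (lin a) (Poly_Mapping.single k 1) = a $ k"
proof -
  have "Poly_Mapping.single i (1::nat) = Poly_Mapping.single k 1 \<longleftrightarrow> i = k" for i
    by (metis lookup_single_eq lookup_single_not_eq zero_neq_one)
  then show ?thesis
    by (simp add: lin_def lookup_sum const_poly_def var_def mult_single lookup_single when_def
        del: One_nat_def)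
qed

lemma lin_eq_iff [simp]: "lin a = lin b \<longleftrightarrow> a = b"
  by (metis lookup_lin vec_eq_iff)

lemma lin_0 [simp]: "lin 0 = 0"
  by (simp add: lin_def)

lemma lin_eq_0_iff [simp]: "lin a = 0 \<longleftrightarrow> a = 0"
  by (metis lin_0 lin_eq_iff)

text \<open>The substitution \<open>x \<mapsto> x - a(x) v\<close>; for \<open>a(v) = 1\<close> it is a retraction of \<open>S\<close> with kernel \<open>(a)\<close>.\<close>

definition retract :: "'a::field ^ 'n::finite \<Rightarrow> 'a ^ 'n \<Rightarrow> ('a, 'n) coord_ring \<Rightarrow> ('a, 'n) coord_ring" where
  "retract a v = insertion const_poly (\<lambda>i. var i - const_poly (v $ i) * lin a)"

lemma retract_lin: "retract a v (lin b) = lin (b - cdot b v *s a)"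
proof -
  have "retract a v (lin b) = lin b - const_poly (cdot b v) * lin a"
    unfolding retract_def lin_def[of b]
    by (simp add: subst.insertion_sum subst.insertion_mult algebra_simps sum_subtractf cdot_def
        const_poly_sum const_poly_mult sum_distrib_left)
  then show ?thesis by (simp add: lin_diff lin_scale)
qed

lemma retract_self: "cdot a v = 1 \<Longrightarrow> retract a v (lin a) = 0"
  by (simp add: retract_lin)

text \<open>Modulo \<open>lin a\<close> the substitution fixes every variable and constant, and
  congruences pass to sums and products.\<close>

lemma lin_dvd_diff_retract: "lin a dvd p - retract a v p"
proof (induction p rule: coord_ring_induct)
  case (add p q)
  then show ?case
    using dvd_add[OF add] by (simp add: retract_def subst.insertion_add algebra_simps)
next
  case (mult p q)
  have "p * q - retract a v (p * q) =
      (p - retract a v p) * q + retract a v p * (q - retract a v q)"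
    by (simp add: retract_def subst.insertion_mult algebra_simps)
  then show ?case using mult by (metis dvd_add dvd_mult dvd_mult2)
qed (simp_all add: retract_def)

text \<open>\<open>p\<close> is congruent to its retraction modulo \<open>lin a\<close>, and the
  retraction kills \<open>lin a\<close>. Divisibility thus becomes an equation that respects
  products and determinants.\<close>

lemma lin_dvd_iff:
  assumes "cdot a v = 1" shows "lin a dvd p \<longleftrightarrow> retract a v p = 0"
proof
  assume "lin a dvd p"
  then have "retract a v (lin a) dvd retract a v p"
    unfolding retract_def by (rule subst.insertion_dvd)
  then show "retract a v p = 0" using retract_self[OF assms] by simp
qed (use lin_dvd_diff_retract[of a p v] in simp)

lemma hdeg_retract: "hdeg p z \<Longrightarrow> hdeg (retract a v p) z"
  unfolding retract_def by (rule hdeg_insertion) (auto intro!: hdeg_diff hdeg_const_mult)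

text \<open>The multiples of \<open>lin a\<close> form the kernel of a ring homomorphism into a
  domain.\<close>

lemma prime_elem_lin:
  assumes "a \<noteq> 0" shows "prime_elem (lin a)"
proof -
  obtain k where v: "cdot a (axis k (inverse (a $ k))) = 1" (is "cdot a ?v = 1")
    using assms by (rule cdot_eq_1_obtain)
  show ?thesis
  proof (rule prime_elemI)
    show "\<not> lin a dvd 1"
      unfolding lin_dvd_iff[OF v] by (simp add: retract_def)
    show "lin a dvd p \<or> lin a dvd q" if "lin a dvd p * q" for p q
      using that unfolding lin_dvd_iff[OF v]
      by (simp add: retract_def subst.insertion_mult coord_ring_mult_eq_0_iff)
  qed (use assms in simp)
qed

lemma lin_dvd_lin_imp_scale:
  assumes "a \<noteq> 0" "lin a dvd lin b" shows "\<exists>c. b = c *s a"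
proof -
  obtain k where v: "cdot a (axis k (inverse (a $ k))) = 1" (is "cdot a ?v = 1")
    using assms(1) by (rule cdot_eq_1_obtain)
  have "b = cdot b ?v *s a"
    using assms(2) unfolding lin_dvd_iff[OF v] retract_lin by simp
  then show ?thesis ..
qed

subsection \<open>Determinants\<close>

text \<open>Expanding row \<open>k\<close> leaves only the summand \<open>j = k\<close>; every other
  one repeats a row.\<close>

lemma det_row_combination:
  fixes M :: "'a::comm_ring_1 ^ 'n ^ 'n"
  shows "det (\<chi> i. if i = k then \<Sum>j\<in>UNIV. x j *s M $ j else M $ i) = x k * det M"
proof -
  have summand: "det (\<chi> i. if i = k then x j *s M $ j else M $ i) = (if j = k then x k * det M else 0)" for j
  proof -
    have "det (\<chi> i. if i = k then x j *s M $ j else M $ i) =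
        x j * det (\<chi> i. if i = k then M $ j else M $ i)"
      by (rule det_row_mul)
    moreover have "det (\<chi> i. if i = k then M $ j else M $ i) = 0" if "j \<noteq> k"
      by (rule det_identical_rows[OF that]) (simp add: row_def that)
    moreover have "(\<chi> i. if i = k then M $ k else M $ i) = M"
      by (simp add: vec_eq_iff)
    ultimately show ?thesis by auto
  qed
  show ?thesis
    by (subst det_linear_row_sum) (simp_all add: summand)
qed

lemma det_column_combination:
  fixes M :: "'a::comm_ring_1 ^ 'n ^ 'n"
  shows "det (\<chi> i j. if j = k then \<Sum>l\<in>UNIV. M $ i $ l * x l else M $ i $ j) = x k * det M"
proof -
  let ?L = "\<chi> i j. if j = k then \<Sum>l\<in>UNIV. M $ i $ l * x l else M $ i $ j"
  have "transpose ?L =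
      (\<chi> i. if i = k then \<Sum>j\<in>UNIV. x j *s transpose M $ j else transpose M $ i)"
    by (auto simp: vec_eq_iff transpose_def mult.commute)
  then have "det (transpose ?L) = x k * det (transpose M)"
    by (simp only: det_row_combination)
  then show ?thesis by (simp only: det_transpose)
qed

lemma dvd_det_column:
  fixes M :: "'a::comm_ring_1 ^ 'n ^ 'n"
  assumes "\<And>i. p dvd M $ i $ k" shows "p dvd det M"
proof -
  obtain y where y: "\<And>i. M $ i $ k = p * y i" using assms unfolding dvd_def by metis
  have "transpose M = (\<chi> i. if i = k then p *s (\<chi> j. y j) else transpose M $ i)"
    by (auto simp: vec_eq_iff transpose_def y)
  then have "det (transpose M) = det (\<chi> i. if i = k then p *s (\<chi> j. y j) else transpose M $ i)"
    by (rule arg_cong)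
  also have "\<dots> = p * det (\<chi> i. if i = k then (\<chi> j. y j) else transpose M $ i)"
    by (rule det_row_mul)
  finally show ?thesis by simp
qed

text \<open>Putting the combination of the columns with weights \<open>x\<close> into column
  \<open>k\<close> multiplies the determinant by \<open>x k\<close> and makes that column divisible
  by \<open>p\<close>. With the coefficients of a form as weights, logarithmic rows provide the
  hypothesis.\<close>

lemma dvd_det_of_dvd_mult:
  fixes M :: "'a::comm_ring_1 ^ 'n ^ 'n"
  assumes "\<And>i. p dvd (\<Sum>l\<in>UNIV. M $ i $ l * x l)" shows "p dvd x k * det M"
proof -
  have "p dvd det (\<chi> i j. if j = k then \<Sum>l\<in>UNIV. M $ i $ l * x l else M $ i $ j)"
    by (rule dvd_det_column[of p _ k]) (simp add: assms)
  then show ?thesis by (simp only: det_column_combination)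
qed

text \<open>The numerators in Cramer's rule for writing \<open>w\<close> in the rows of
  \<open>M\<close>.\<close>

definition row_minor :: "'a::comm_ring_1 ^ 'n ^ 'n \<Rightarrow> 'a ^ 'n \<Rightarrow> 'n \<Rightarrow> 'a" where
  "row_minor M w i = det (\<chi> r. if r = i then w else M $ r)"

lemma row_expansion:
  fixes M :: "('a::field, 'm::finite) coord_ring ^ 'n ^ 'n"
  assumes "det M \<noteq> 0"
  shows "(\<Sum>i\<in>UNIV. row_minor M w i *s M $ i) = det M *s w"
proof -
  define N where "N = transpose M"
  \<comment> \<open>The entries of the adjugate of \<open>M\<close>, obtained as determinants of its
    transpose with one row replaced by a unit vector.\<close>
  define B where "B k i = row_minor N (axis i 1) k" for k i
  have B: "(\<Sum>i\<in>UNIV. B k i * M $ i $ l) = (if k = l then det M else 0)" for k l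
  proof -
    have "N $ l = (\<Sum>i\<in>UNIV. N $ l $ i *s axis i 1)"
      by (simp add: vec_eq_iff axis_def if_distrib[of "\<lambda>t. _ * t"] cong: if_cong)
    then have "row_minor N (N $ l) k = row_minor N (\<Sum>i\<in>UNIV. N $ l $ i *s axis i 1) k" by simp
    also have "\<dots> = (\<Sum>i\<in>UNIV. N $ l $ i * B k i)"
      unfolding row_minor_def B_def by (subst det_linear_row_sum) (simp_all add: det_row_mul)
    also have "row_minor N (N $ l) k = (if k = l then det N else 0)"
      using det_row_combination[of k "\<lambda>j. if j = l then 1 else 0" N]
      by (simp add: row_minor_def if_distrib[of "\<lambda>t. t *s _"] cong: if_cong)
    finally show ?thesis
      unfolding N_def det_transpose by (simp add: transpose_def mult.commute)
  qed
  define x where "x i = (\<Sum>k\<in>UNIV. w $ k * B k i)" for i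
  have x: "det M *s w = (\<Sum>i\<in>UNIV. x i *s M $ i)"
  proof -
    have "det M * w $ l = (\<Sum>i\<in>UNIV. x i * M $ i $ l)" for l
    proof -
      have "(\<Sum>i\<in>UNIV. x i * M $ i $ l) = (\<Sum>i\<in>UNIV. \<Sum>k\<in>UNIV. w $ k * (B k i * M $ i $ l))"
        by (simp add: x_def sum_distrib_right mult.assoc)
      also have "\<dots> = (\<Sum>k\<in>UNIV. w $ k * (\<Sum>i\<in>UNIV. B k i * M $ i $ l))"
        by (subst sum.swap) (simp add: sum_distrib_left)
      also have "\<dots> = det M * w $ l"
        by (simp add: B if_distrib[of "\<lambda>t. _ * t"] mult.commute cong: if_cong)
      finally show ?thesis ..
    qed
    then show ?thesis by (simp add: vec_eq_iff)
  qed
  \<comment> \<open>The coefficients found must be the Cramer numerators: inserting the expansion of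
    \<open>det M *s w\<close> into row \<open>i\<close> gives this equation multiplied by
    \<open>det M\<close>, which cancels.\<close>
  have "row_minor M w i = x i" for i
  proof -
    have "det M * row_minor M w i = row_minor M (det M *s w) i"
      by (simp add: row_minor_def det_row_mul)
    also have "\<dots> = x i * det M"
      unfolding x row_minor_def by (rule det_row_combination)
    finally show ?thesis using assms by (metis coord_ring_mult_left_cancel mult.commute)
  qed
  then show ?thesis by (simp add: x)
qed

text \<open>All Leibniz terms have the same degree, since a permutation does not change the total of
  the column weights \<open>u\<close>.\<close>

lemma hdeg_det:
  fixes M :: "('a::field, 'm::finite) coord_ring ^ 'n ^ 'n"
  assumes "\<And>i j. hdeg (M $ i $ j) (w i - u j)"
  shows "hdeg (det M) (sum w UNIV - sum u UNIV)"
  unfolding det_def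
proof (rule hdeg_sum)
  fix \<pi> :: "'n \<Rightarrow> 'n" assume "\<pi> \<in> {p. p permutes UNIV}"
  then have "sum u UNIV = (\<Sum>i\<in>UNIV. u (\<pi> i))"
    using sum.permute[of \<pi> UNIV u] by (simp add: o_def)
  moreover have "hdeg (\<Prod>i\<in>UNIV. M $ i $ \<pi> i) (\<Sum>i\<in>UNIV. w i - u (\<pi> i))"
    by (rule hdeg_prod) (rule assms)
  ultimately have "hdeg (\<Prod>i\<in>UNIV. M $ i $ \<pi> i) (sum w UNIV - sum u UNIV)"
    by (simp add: sum_subtractf)
  then show "hdeg (of_int (sign \<pi>) * (\<Prod>i\<in>UNIV. M $ i $ \<pi> i)) (sum w UNIV - sum u UNIV)"
    using hdeg_mult[OF hdeg_of_int] by force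
qed

subsection \<open>Saito's criterion\<close>

text \<open>The derivation with coefficient vector \<open>f\<close> applied to the linear form
  \<open>a\<close>; operators themselves enter later, through \<open>der\<close>.\<close>

definition pair :: "'a::field ^ 'n::finite \<Rightarrow> ('a, 'n) coord_ring ^ 'n \<Rightarrow> ('a, 'n) coord_ring" where
  "pair a f = (\<Sum>i\<in>UNIV. const_poly (a $ i) * f $ i)"

lemma pair_add: "pair a (f + g) = pair a f + pair a g"
  and pair_diff: "pair a (f - g) = pair a f - pair a g"
  and pair_scale: "pair a (p *s f) = p * pair a f"
  and pair_diff_left: "pair (a - a') f = pair a f - pair a' f"
  and pair_scale_left: "pair (c *s a) f = const_poly c * pair a f"
  by (simp_all add: pair_def algebra_simps sum.distrib sum_subtractf sum_distrib_left
      const_poly_diff const_poly_mult)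

lemma pair_sum: "pair a (sum f I) = (\<Sum>i\<in>I. pair a (f i))"
  by (induction I rule: infinite_finite_induct) (auto simp: pair_add, auto simp: pair_def)

lemma hdeg_pair: "(\<And>k. hdeg (f $ k) z) \<Longrightarrow> hdeg (pair a f) z"
  unfolding pair_def by (intro hdeg_sum hdeg_const_mult)

definition const_vec :: "'a::field ^ 'n::finite \<Rightarrow> ('a, 'n) coord_ring ^ 'n" where
  "const_vec u = (\<chi> i. const_poly (u $ i))"

lemma pair_const_vec: "pair a (const_vec u) = const_poly (cdot a u)"
  by (simp add: pair_def const_vec_def cdot_def const_poly_sum const_poly_mult)

lemma const_poly_det:
  fixes M :: "'a::field ^ 'm::finite ^ 'm"
  shows "const_poly (det M) = (det (\<chi> i j. const_poly (M $ i $ j)) :: ('a, 'n::finite) coord_ring)"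
proof -
  have "const_poly (prod f I) = (\<Prod>i\<in>I. const_poly (f i) :: ('a, 'n) coord_ring)"
    for f :: "'m \<Rightarrow> 'a" and I
    by (induction I rule: infinite_finite_induct) (auto simp: const_poly_mult)
  moreover have "const_poly (of_int k :: 'a) = (of_int k :: ('a, 'n) coord_ring)" for k
    by (simp add: const_poly_def)
  ultimately show ?thesis
    by (simp add: det_def const_poly_sum const_poly_mult)
qed

lemma dvd_const_mult_cancel:
  assumes "p dvd const_poly c * q" "c \<noteq> 0" shows "p dvd q"
proof -
  have "q = (const_poly c * const_poly (inverse c)) * q"
    by (simp add: const_poly_inverse[OF assms(2)])
  also have "\<dots> = const_poly (inverse c) * (const_poly c * q)"
    by (simp only: ac_simps)
  finally have q: "q = const_poly (inverse c) * (const_poly c * q)" .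
  show ?thesis by (subst q, rule dvd_mult) (rule assms(1))
qed

text \<open>An arrangement seen through its normal vectors; non-divisibility says that different
  indices give different hyperplanes. The index set is abstract, so a deletion is again an
  instance.\<close>

locale linear_forms =
  fixes A :: "'h set" and b :: "'h \<Rightarrow> 'a::field ^ 'n::finite"
  assumes finite_A: "finite A" and nonzero: "H \<in> A \<Longrightarrow> b H \<noteq> 0"
    and not_dvd: "H \<in> A \<Longrightarrow> K \<in> A \<Longrightarrow> H \<noteq> K \<Longrightarrow> \<not> lin (b H) dvd lin (b K)"
begin

definition log_vecs :: "(('a, 'n) coord_ring ^ 'n) set" where
  "log_vecs = {f. \<forall>H\<in>A. lin (b H) dvd pair (b H) f}"

definition Q :: "('a, 'n) coord_ring" where "Q = (\<Prod>H\<in>A. lin (b H))"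

lemma log_vecs_sum: "(\<And>i. i \<in> I \<Longrightarrow> f i \<in> log_vecs) \<Longrightarrow> sum f I \<in> log_vecs"
  by (auto simp: log_vecs_def pair_sum intro!: dvd_sum)

lemma log_vecs_scale: "f \<in> log_vecs \<Longrightarrow> p *s f \<in> log_vecs"
  by (auto simp: log_vecs_def pair_scale)

lemma prime_form: "H \<in> A \<Longrightarrow> prime_elem (lin (b H))"
  using nonzero by (rule prime_elem_lin)

lemma Q_nonzero: "Q \<noteq> 0"
  using finite_A nonzero by (auto simp: Q_def coord_ring_prod_eq_0_iff)

lemma hdeg_Q: "hdeg Q (int (card A))"
  using hdeg_prod[of A "\<lambda>H. lin (b H)" "\<lambda>_. 1"] by (simp add: Q_def)

lemma form_dvd_Q: "H \<in> A \<Longrightarrow> lin (b H) dvd Q"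
  unfolding Q_def using finite_A by (rule dvd_prodI)

text \<open>Combining the columns of \<open>M\<close> with the coefficients of \<open>b H\<close>
  gives the values of the rows on that form, all divisible by it. So each of the pairwise
  non-associated primes \<open>lin (b H)\<close> divides the determinant.\<close>

lemma Q_dvd_det:
  assumes "\<And>r. M $ r \<in> log_vecs" shows "Q dvd det M"
  unfolding Q_def
proof (rule prod_primes_dvd[OF finite_A prime_form _ not_dvd])
  fix H assume H: "H \<in> A"
  obtain k where k: "b H $ k \<noteq> 0" using nonzero[OF H] by (auto simp: vec_eq_iff)
  have "lin (b H) dvd const_poly (b H $ k) * det M"
    using assms H by (intro dvd_det_of_dvd_mult) (simp add: log_vecs_def pair_def mult.commute)
  then show "lin (b H) dvd det M" using k by (rule dvd_const_mult_cancel)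
qed

text \<open>Replacing a row of \<open>M\<close> by \<open>f\<close> keeps all rows logarithmic, so
  \<open>Q\<close> divides each Cramer numerator and cancels against \<open>det M\<close>.\<close>

lemma saito_span:
  assumes "\<And>r. M $ r \<in> log_vecs" "det M = const_poly c * Q" "c \<noteq> 0" "f \<in> log_vecs"
  shows "\<exists>x. f = (\<Sum>r\<in>UNIV. x r *s M $ r)"
proof -
  have "Q dvd row_minor M f r" for r
    unfolding row_minor_def by (rule Q_dvd_det) (use assms in auto)
  then obtain y where y: "\<And>r. row_minor M f r = Q * y r" unfolding dvd_def by metis
  have "det M \<noteq> 0" using assms(2,3) Q_nonzero by (simp add: coord_ring_mult_eq_0_iff)
  from row_expansion[OF this, of f]
  have "Q * (\<Sum>r\<in>UNIV. y r * M $ r $ l) = Q * (const_poly c * f $ l)" for l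
    by (simp add: y assms(2) vec_eq_iff sum_distrib_left algebra_simps)
  then have *: "(\<Sum>r\<in>UNIV. y r * M $ r $ l) = const_poly c * f $ l" for l
    using Q_nonzero coord_ring_mult_left_cancel by blast
  have "f $ l = (\<Sum>r\<in>UNIV. const_poly (inverse c) * y r * M $ r $ l)" for l
  proof -
    have "(\<Sum>r\<in>UNIV. const_poly (inverse c) * y r * M $ r $ l) =
        const_poly (inverse c) * (const_poly c * f $ l)"
      by (simp add: mult.assoc *[symmetric] sum_distrib_left)
    also have "\<dots> = (const_poly c * const_poly (inverse c)) * f $ l"
      by (simp only: ac_simps)
    finally have "(\<Sum>r\<in>UNIV. const_poly (inverse c) * y r * M $ r $ l) =
        (const_poly c * const_poly (inverse c)) * f $ l" .
    then show ?thesis by (simp add: const_poly_inverse[OF assms(3)])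
  qed
  then show ?thesis
    by (intro exI[of _ "\<lambda>r. const_poly (inverse c) * y r"]) (simp add: vec_eq_iff)
qed

lemma det_of_spanning:
  assumes span: "\<And>f. f \<in> log_vecs \<Longrightarrow> \<exists>x. f = (\<Sum>r\<in>UNIV. x r *s M $ r)"
    and F: "\<And>r. F $ r \<in> log_vecs"
  shows "det M dvd det F"
proof -
  from span[OF F] obtain x where "\<And>r. F $ r = (\<Sum>s\<in>UNIV. x r s *s M $ s)" by metis
  then have "F = (\<chi> r s. x r s) ** M"
    by (simp add: vec_eq_iff matrix_matrix_mult_def)
  then show ?thesis by (simp add: det_mul)
qed

text \<open>In coordinates with \<open>b H\<close> as first coordinate form, \<open>Q \<partial>\<^sub>1\<close> and \<open>(Q / b H) \<partial>\<^sub>i\<close> for \<open>i > 1\<close>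
  are logarithmic; so, up to a unit, \<open>det M / Q\<close> divides a power of \<open>Q / b H\<close> for every \<open>H\<close>.\<close>

lemma det_of_homogeneous_spanning:
  assumes M: "\<And>r. M $ r \<in> log_vecs"
    and span: "\<And>f. f \<in> log_vecs \<Longrightarrow> \<exists>x. f = (\<Sum>r\<in>UNIV. x r *s M $ r)"
    and hom: "\<And>r k. hdeg (M $ r $ k) (e r)"
  shows "(\<exists>c. c \<noteq> 0 \<and> det M = const_poly c * Q) \<and> sum e UNIV = int (card A)"
proof -
  obtain h where h: "det M = Q * h" using Q_dvd_det[OF M] by (rule dvdE)
  \<comment> \<open>All partial derivatives times \<open>Q\<close> are logarithmic, which bounds the
    cofactor: \<open>h\<close> divides a power of \<open>Q\<close>.\<close>
  let ?D = "\<chi> r::'n. Q *s const_vec (axis r 1)"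
  have "det ?D = Q ^ CARD('n) * det (\<chi> r::'n. const_vec (axis r (1::'a)))"
    by (simp add: det_rows_mul)
  also have "(\<chi> r::'n. const_vec (axis r (1::'a))) = (mat 1 :: ('a, 'n) coord_ring ^ 'n ^ 'n)"
    by (auto simp: vec_eq_iff mat_def const_vec_def axis_def)
  finally have "det ?D = Q ^ CARD('n)" by simp
  moreover have "det M dvd det ?D"
    by (rule det_of_spanning[OF span])
      (auto simp: log_vecs_def pair_scale pair_const_vec intro!: dvd_mult2 form_dvd_Q)
  ultimately have h_power: "h dvd Q ^ CARD('n)" unfolding h by (simp add: dvd_mult_right)
  have "\<not> lin (b H) dvd h" if H: "H \<in> A" for H
  proof
    assume dvd_h: "lin (b H) dvd h"
    obtain k where k: "b H $ k \<noteq> 0" "cdot (b H) (axis k (inverse (b H $ k))) = 1"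
      using nonzero[OF H] by (rule cdot_eq_1_obtain)
    define v :: "'a ^ 'n" where "v = axis k (inverse (b H $ k))"
    \<comment> \<open>The rows of \<open>G\<close> are \<open>v\<close>, on which \<open>b H\<close>
      is 1, and vectors on which \<open>b H\<close> vanishes; \<open>E\<close> inverts this change
      of coordinates, so \<open>det G\<close> is nonzero.\<close>
    define G :: "'a ^ 'n ^ 'n" where "G = (\<chi> r. if r = k then v else axis r 1 - b H $ r *s v)"
    define E :: "'a ^ 'n ^ 'n" where
      "E = (\<chi> r j. if j = k then b H $ r else if j = r then 1 else 0)"
    define Q' where "Q' = (\<Prod>K\<in>A - {H}. lin (b K))"
    have Q: "Q = lin (b H) * Q'"
      unfolding Q_def Q'_def using finite_A H by (rule prod.remove)
    have "E ** G = mat 1"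
    proof -
      have "(E ** G) $ r $ l = (if r = l then 1 else 0)" for r l
      proof -
        have "E $ r $ j * G $ j $ l = (if j = k then b H $ r * v $ l else 0) +
            (if j = r then if r = k then 0 else G $ r $ l else 0)" for j
          by (simp add: E_def G_def)
        then have "(E ** G) $ r $ l = b H $ r * v $ l + (if r = k then 0 else G $ r $ l)"
          by (simp add: matrix_matrix_mult_def sum.distrib)
        then show ?thesis using k(1) by (auto simp: G_def v_def axis_def)
      qed
      then show ?thesis by (simp add: vec_eq_iff mat_def)
    qed
    then have "det G \<noteq> 0" by (metis det_I det_mul mult_zero_right zero_neq_one)
    \<comment> \<open>Row \<open>k\<close> is transversal to \<open>H\<close> and needs the full
      factor \<open>Q\<close>; the other rows are tangent to \<open>H\<close> and need only
      \<open>Q'\<close>. The determinant therefore contains \<open>lin (b H)\<close> just once,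
      leaving none for \<open>h\<close>.\<close>
    let ?F = "\<chi> r. (if r = k then Q else Q') *s const_vec (G $ r)"
    have F: "?F $ r \<in> log_vecs" for r
    proof (cases "r = k")
      case True
      then show ?thesis by (auto simp: log_vecs_def pair_scale intro!: dvd_mult2 form_dvd_Q)
    next
      case False
      have "lin (b K) dvd pair (b K) (Q' *s const_vec (G $ r))" if K: "K \<in> A" for K
      proof (cases "K = H")
        case True
        have "cdot (b H) (axis r 1 - b H $ r *s v) = 0"
          using k(1) by (simp add: cdot_def v_def axis_def algebra_simps sum_subtractf
              if_distrib[of "\<lambda>t. _ * t"] cong: if_cong)
        then show ?thesis using True False by (simp add: pair_scale pair_const_vec G_def)
      next
        case False
        then have "lin (b K) dvd Q'"
          unfolding Q'_def using finite_A K by (intro dvd_prodI) auto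
        then show ?thesis by (simp add: pair_scale)
      qed
      then show ?thesis using False by (simp add: log_vecs_def)
    qed
    have "det ?F = (\<Prod>r\<in>UNIV. if r = k then Q else Q') * det (\<chi> r. const_vec (G $ r))"
      by (rule det_rows_mul)
    also have "(\<chi> r. const_vec (G $ r)) = (\<chi> i j. const_poly (G $ i $ j))"
      by (simp add: vec_eq_iff const_vec_def)
    also have "det \<dots> = const_poly (det G)" by (rule const_poly_det[symmetric])
    also have "(\<Prod>r\<in>UNIV. if r = k then Q else Q') = Q * (\<Prod>r\<in>UNIV - {k}. if r = k then Q else Q')"
      by (subst prod.remove[of _ k]) auto
    also have "(\<Prod>r\<in>UNIV - {k}. if r = k then Q else Q') = Q' ^ (CARD('n) - 1)"
      by simp
    finally have "Q * h dvd Q * (const_poly (det G) * Q' ^ (CARD('n) - 1))"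
      using det_of_spanning[OF span F] by (simp add: h ac_simps)
    then have "h dvd const_poly (det G) * Q' ^ (CARD('n) - 1)"
      using Q_nonzero by (rule coord_ring_dvd_mult_left_cancel)
    then have "h dvd Q' ^ (CARD('n) - 1)" using \<open>det G \<noteq> 0\<close> by (rule dvd_const_mult_cancel)
    with dvd_h have "lin (b H) dvd Q' ^ (CARD('n) - 1)" by (rule dvd_trans)
    then have "lin (b H) dvd Q'" by (rule prime_elem_dvd_power[OF prime_form[OF H]])
    then have "\<exists>K\<in>A - {H}. lin (b H) dvd lin (b K)"
      unfolding Q'_def using finite_A prime_form[OF H] by (intro prime_dvd_prodD) auto
    then show False using H not_dvd by auto
  qed
  then have "h dvd 1"
    using h_power unfolding Q_def
    by (intro dvd_prod_primes_imp_unit[OF finite_A, of "\<lambda>H. lin (b H)"] prime_form) auto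
  then obtain h' where h': "1 = h * h'" by (rule dvdE)
  then have nz: "h \<noteq> 0" "h' \<noteq> 0" by auto
  \<comment> \<open>\<open>h\<close> and its inverse are homogeneous of opposite degrees, neither of
    them negative; so both degrees are 0 and \<open>h\<close> is a constant.\<close>
  have "hdeg (det M) (sum e UNIV)"
    using hdeg_det[of M e "\<lambda>_. 0"] hom by simp
  then have deg_h: "hdeg h (sum e UNIV - card A)"
    unfolding h using hdeg_Q Q_nonzero by (rule hdeg_mult_cancel)
  have "hdeg (h * h') 0" by (simp flip: h')
  then have "hdeg h' (0 - (sum e UNIV - card A))"
    using deg_h nz(1) by (rule hdeg_mult_cancel)
  then have deg: "sum e UNIV = int (card A)"
    using hdeg_nonneg[OF deg_h nz(1)] hdeg_nonneg[of h'] nz(2) by fastforce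
  then have "h = const_poly (Poly_Mapping.lookup h 0)"
    using deg_h hdeg_0_imp_const by simp
  then show ?thesis using deg nz h by (metis const_poly_0 mult.commute)
qed

end

subsection \<open>Relations modulo one form\<close>

lemma retract_mult: "retract a v (p * q) = retract a v p * retract a v q"
  and retract_diff: "retract a v (p - q) = retract a v p - retract a v q"
  and retract_const [simp]: "retract a v (const_poly c) = const_poly c"
  and retract_zero [simp]: "retract a v 0 = 0"
  and retract_sum: "retract a v (sum f I) = (\<Sum>i\<in>I. retract a v (f i))"
  and retract_prod: "retract a v (prod f I) = (\<Prod>i\<in>I. retract a v (f i))"
  and retract_dvd: "p dvd q \<Longrightarrow> retract a v p dvd retract a v q"
  and retract_det: "retract a v (det M) = det (\<chi> i j. retract a v (M $ i $ j))"
  by (simp_all add: retract_def subst.insertion_mult subst.insertion_diff subst.insertion_sum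
      subst.insertion_prod subst.insertion_det subst.insertion_dvd)

lemma retract_pair: "retract a v (pair u f) = (\<Sum>l\<in>UNIV. retract a v (f $ l) * const_poly (u $ l))"
  by (simp add: pair_def retract_sum retract_mult mult.commute)

section \<open>Evaluation at a point\<close>

definition eval_at :: "'a::field ^ 'n::finite \<Rightarrow> ('a, 'n) coord_ring \<Rightarrow> 'a" where
  "eval_at x = insertion (\<lambda>c. c) (\<lambda>i. x $ i)"

lemma eval_at_add: "eval_at x (p + q) = eval_at x p + eval_at x q"
  and eval_at_mult: "eval_at x (p * q) = eval_at x p * eval_at x q"
  and eval_at_const [simp]: "eval_at x (const_poly c) = c"
  and eval_at_var [simp]: "eval_at x (var i) = x $ i"
  and eval_at_zero [simp]: "eval_at x 0 = 0"
  and eval_at_one [simp]: "eval_at x 1 = 1"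
  and eval_at_sum: "eval_at x (sum f I) = (\<Sum>i\<in>I. eval_at x (f i))"
  and eval_at_prod: "eval_at x (prod f I) = (\<Prod>i\<in>I. eval_at x (f i))"
  and eval_at_det: "eval_at x (det M) = det (\<chi> i j. eval_at x (M $ i $ j))"
  by (simp_all add: eval_at_def ev.insertion_add ev.insertion_mult ev.insertion_sum
      ev.insertion_prod ev.insertion_det)

lemma eval_at_lin [simp]: "eval_at x (lin a) = cdot a x"
  by (simp add: lin_def eval_at_sum eval_at_mult cdot_def)

lemma eval_at_retract:
  assumes "cdot a x = 0" shows "eval_at x (retract a v p) = eval_at x p"
proof -
  obtain q where "p - retract a v p = lin a * q" using lin_dvd_diff_retract by (rule dvdE)
  then have "p = retract a v p + lin a * q" by (simp add: algebra_simps)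
  then have "eval_at x p = eval_at x (retract a v p + lin a * q)" by simp
  then show ?thesis using assms by (simp add: eval_at_add eval_at_mult)
qed

context linear_forms
begin

text \<open>The restrictions to \<open>ker (b H)\<close> of the rows of \<open>T\<close> satisfy one relation.
  By Cramer its coefficients are the minors \<open>D i\<close> modulo \<open>b H\<close>; these share the factor \<open>P\<close>,
  the product of the restrictions of the forms in \<open>C\<close>, and dividing by it gives \<open>g\<close>.
  The forms outside \<open>C\<close> are what remains of \<open>Q\<close>.\<close>

lemma relation_modulo_form:
  assumes H: "H \<in> A" and T: "\<And>r. T $ r \<in> log_vecs"
    and det: "det T = const_poly c * Q" "c \<noteq> 0"
    and hom: "\<And>r k. hdeg (T $ r $ k) (e r)" and sum_e: "sum e UNIV = int (card A)"
    and C: "C \<subseteq> A - {H}"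
      "\<And>K L s t. K \<in> C \<Longrightarrow> L \<in> C \<Longrightarrow> K \<noteq> L \<Longrightarrow> b L \<noteq> s *s b K + t *s b H"
    and x: "cdot (b H) x = 0" "\<And>K. K \<in> A - {H} - C \<Longrightarrow> cdot (b K) x \<noteq> 0"
  shows "\<exists>g \<eta>. (\<forall>i. hdeg (g i) (int (card A) - int (card C) - e i)) \<and>
    (\<Sum>i\<in>UNIV. g i *s T $ i) = lin (b H) *s \<eta> \<and> eval_at x (pair (b H) \<eta>) \<noteq> 0"
proof -
  obtain k where "cdot (b H) (axis k (inverse (b H $ k))) = 1"
    using nonzero[OF H] by (rule cdot_eq_1_obtain)
  then obtain v where v: "cdot (b H) v = 1" by blast
  let ?\<alpha> = "lin (b H)"
  let ?s = "retract (b H) v"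
  define D where "D i = row_minor T (const_vec v) i" for i
  \<comment> \<open>\<open>u K\<close> is \<open>b K\<close> corrected by a multiple of
    \<open>b H\<close> so that it vanishes on \<open>v\<close>; its form is the retraction of that
    of \<open>K\<close> and represents the restriction to \<open>H\<close>.\<close>
  define u where "u K = b K - cdot (b K) v *s b H" for K
  define P where "P = (\<Prod>K\<in>C. lin (u K))"
  have "finite C" using C(1) finite_A by (auto intro: finite_subset)
  have u_v: "cdot (u K) v = 0" for K
    by (simp add: u_def cdot_diff cdot_scale v)
  have s_form: "?s (lin (b K)) = lin (u K)" for K
    by (simp add: u_def retract_lin)
  have u_nonzero: "u K \<noteq> 0" if "K \<in> A" "K \<noteq> H" for K
  proof
    assume "u K = 0"
    then have "lin (b K) = const_poly (cdot (b K) v) * ?\<alpha>"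
      by (simp add: u_def lin_scale[symmetric])
    then show False using not_dvd[OF H that(1)] that(2) by auto
  qed
  have P_dvd: "P dvd ?s (D i)" for i
    unfolding P_def
  proof (rule prod_primes_dvd[OF \<open>finite C\<close>])
    fix K assume K: "K \<in> C"
    then have KA: "K \<in> A" "K \<noteq> H" using C(1) by auto
    show "prime_elem (lin (u K))" using u_nonzero[OF KA] by (rule prime_elem_lin)
    obtain l where l: "u K $ l \<noteq> 0" using u_nonzero[OF KA] by (auto simp: vec_eq_iff)
    define M where "M = (\<chi> r. if r = i then const_vec v else T $ r)"
    \<comment> \<open>Row \<open>i\<close> is the direction \<open>v\<close>, killed by
      \<open>u K\<close>; every other row is logarithmic along both \<open>H\<close> and
      \<open>K\<close>.\<close>
    have "lin (u K) dvd ?s (pair (u K) (M $ r))" for r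
    proof (cases "r = i")
      case True
      then show ?thesis by (simp add: M_def pair_const_vec u_v)
    next
      case False
      have "?s (pair (b H) (T $ r)) = 0"
        using T H by (simp add: log_vecs_def flip: lin_dvd_iff[OF v])
      moreover have "lin (u K) dvd ?s (pair (b K) (T $ r))"
        unfolding s_form[symmetric] by (rule retract_dvd) (use T KA in \<open>simp add: log_vecs_def\<close>)
      ultimately show ?thesis
        using False
        by (simp add: M_def u_def[of K] pair_diff_left pair_scale_left retract_diff retract_mult)
    qed
    then have "lin (u K) dvd const_poly (u K $ l) * det (\<chi> i j. ?s (M $ i $ j))"
      by (intro dvd_det_of_dvd_mult) (simp add: retract_pair)
    then have "lin (u K) dvd det (\<chi> i j. ?s (M $ i $ j))" using l by (rule dvd_const_mult_cancel)
    then show "lin (u K) dvd ?s (D i)"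
      by (simp only: D_def row_minor_def M_def retract_det)
    fix L assume L: "L \<in> C" "L \<noteq> K"
    \<comment> \<open>Proportional restrictions would express \<open>b K\<close> through
      \<open>b L\<close> and \<open>b H\<close>, which is excluded for members of
      \<open>C\<close>.\<close>
    show "\<not> lin (u L) dvd lin (u K)"
    proof
      assume "lin (u L) dvd lin (u K)"
      moreover have "u L \<noteq> 0" using L C(1) by (intro u_nonzero) auto
      ultimately obtain s where "u K = s *s u L" using lin_dvd_lin_imp_scale by blast
      then have "b K = s *s b L + (cdot (b K) v - s * cdot (b L) v) *s b H"
        by (simp add: u_def vec_eq_iff algebra_simps)
      then show False using C(2) K L by blast
    qed
  qed
  then obtain g where g: "\<And>i. ?s (D i) = P * g i" unfolding dvd_def by metis
  have P_nonzero: "P \<noteq> 0"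
    using C(1) u_nonzero by (auto simp: P_def coord_ring_prod_eq_0_iff[OF \<open>finite C\<close>])
  have deg_P: "hdeg P (int (card C))"
    using hdeg_prod[of C "\<lambda>K. lin (u K)" "\<lambda>_. 1"] by (simp add: P_def)
  have deg_g: "hdeg (g i) (int (card A) - int (card C) - e i)" for i
  proof -
    \<comment> \<open>The constant row \<open>i\<close> has weight 0, so \<open>e i\<close> is
      missing from the total degree \<open>card A\<close>.\<close>
    have "hdeg (D i) (sum (\<lambda>r. if r = i then 0 else e r) UNIV - sum (\<lambda>_. 0) (UNIV :: 'n set))"
      unfolding D_def row_minor_def by (rule hdeg_det) (use hom in \<open>auto simp: const_vec_def\<close>)
    moreover have "sum e UNIV = e i + sum (\<lambda>r. if r = i then 0 else e r) UNIV"
      by (simp add: sum.remove[of UNIV i])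
    ultimately have "hdeg (D i) (int (card A) - e i)" using sum_e by simp
    then have "hdeg (P * g i) (int (card A) - e i)" unfolding g[symmetric] by (rule hdeg_retract)
    from hdeg_mult_cancel[OF this deg_P P_nonzero] show ?thesis by (simp add: algebra_simps)
  qed
  have "det T \<noteq> 0" using det Q_nonzero by (simp add: coord_ring_mult_eq_0_iff)
  note expand = row_expansion[OF this, of "const_vec v", folded D_def]
  have "?\<alpha> dvd D i - ?s (D i)" for i by (rule lin_dvd_diff_retract)
  then obtain r where r: "\<And>i. D i - ?s (D i) = ?\<alpha> * r i" unfolding dvd_def by metis
  have D: "D i = P * g i + ?\<alpha> * r i" for i
    using r[of i] by (simp add: g algebra_simps)
  define \<phi> where "\<phi> = (\<Sum>i\<in>UNIV. g i *s T $ i)"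
  define \<rho> where "\<rho> = (\<Sum>i\<in>UNIV. r i *s T $ i)"
  \<comment> \<open>Cramer's identity with its numerators split by \<open>D\<close>; the part
    divisible by \<open>?\<alpha>\<close> is moved to the right.\<close>
  have P\<phi>: "P *s \<phi> = det T *s const_vec v - ?\<alpha> *s \<rho>"
    unfolding expand[symmetric]
    by (simp add: D \<phi>_def \<rho>_def vec_eq_iff sum_distrib_left algebra_simps sum.distrib)
  define Q' where "Q' = (\<Prod>K\<in>A - {H}. lin (b K))"
  have Q: "Q = ?\<alpha> * Q'"
    unfolding Q_def Q'_def using finite_A H by (rule prod.remove)
  have s_P: "?s P = P"
    by (simp add: P_def retract_prod retract_lin u_v)
  \<comment> \<open>\<open>?\<alpha>\<close> divides the right-hand side of \<open>P\<phi>\<close>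
    because it divides \<open>Q\<close>, but it does not divide \<open>P\<close>, which the
    retraction fixes.\<close>
  have "?\<alpha> dvd \<phi> $ l" for l
  proof -
    have "P * \<phi> $ l = det T * const_vec v $ l - ?\<alpha> * \<rho> $ l"
      using P\<phi> by (simp add: vec_eq_iff)
    also have "\<dots> = ?\<alpha> * (const_poly c * Q' * const_vec v $ l - \<rho> $ l)"
      by (simp add: det Q algebra_simps)
    finally have "?\<alpha> dvd P * \<phi> $ l" by simp
    moreover have "\<not> ?\<alpha> dvd P" unfolding lin_dvd_iff[OF v] s_P by (rule P_nonzero)
    ultimately show ?thesis using prime_form[OF H] prime_elem_dvd_multD by blast
  qed
  then obtain y where y: "\<And>l. \<phi> $ l = ?\<alpha> * y l" unfolding dvd_def by metis
  define \<eta> where "\<eta> = (\<chi> l. y l)"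
  have \<eta>: "\<phi> = ?\<alpha> *s \<eta>" by (simp add: \<eta>_def vec_eq_iff y)
  have "\<rho> \<in> log_vecs" unfolding \<rho>_def by (intro log_vecs_sum log_vecs_scale T)
  then obtain t where t: "pair (b H) \<rho> = ?\<alpha> * t" using H unfolding log_vecs_def by (auto elim: dvdE)
  \<comment> \<open>Evaluating \<open>P\<phi>\<close> on \<open>b H\<close> gives a factor
    \<open>?\<alpha>\<close> in every term. After cancelling it, retraction kills the term in
    \<open>t\<close> and \<open>P\<close> cancels in turn; only the forms outside \<open>C\<close>
    survive, and they are nonzero at \<open>x\<close>.\<close>
  have "P * (?\<alpha> * pair (b H) \<eta>) = det T - ?\<alpha> * (?\<alpha> * t)"
    using arg_cong[OF P\<phi>, of "pair (b H)"]
    by (simp add: \<eta> pair_scale pair_diff pair_const_vec v t mult.assoc)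
  then have "?\<alpha> * (P * pair (b H) \<eta>) = ?\<alpha> * (const_poly c * Q' - ?\<alpha> * t)"
    by (simp add: det Q algebra_simps)
  then have "P * pair (b H) \<eta> = const_poly c * Q' - ?\<alpha> * t"
    by (rule coord_ring_mult_left_cancel) (use nonzero[OF H] in simp)
  then have "?s P * ?s (pair (b H) \<eta>) = const_poly c * ?s Q'"
    by (metis retract_mult retract_diff retract_const retract_self[OF v] mult_zero_left diff_zero)
  moreover have "?s Q' = P * (\<Prod>K\<in>A - {H} - C. lin (u K))"
  proof -
    have "?s Q' = (\<Prod>K\<in>A - {H}. lin (u K))" by (simp add: Q'_def retract_prod s_form)
    then show ?thesis
      unfolding P_def using prod.subset_diff[OF C(1), of "\<lambda>K. lin (u K)"] finite_A
      by (simp add: mult.commute)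
  qed
  ultimately have "P * ?s (pair (b H) \<eta>) = P * (const_poly c * (\<Prod>K\<in>A - {H} - C. lin (u K)))"
    by (simp add: s_P algebra_simps)
  then have "?s (pair (b H) \<eta>) = const_poly c * (\<Prod>K\<in>A - {H} - C. lin (u K))"
    using P_nonzero by (rule coord_ring_mult_left_cancel)
  then have "eval_at x (pair (b H) \<eta>) = c * (\<Prod>K\<in>A - {H} - C. cdot (b K) x)"
    using eval_at_retract[OF x(1), of v "pair (b H) \<eta>"]
    by (simp add: eval_at_mult eval_at_prod u_def cdot_diff cdot_scale x(1))
  also have "\<dots> \<noteq> 0" using det(2) x(2) finite_A by auto
  finally show ?thesis
    using deg_g \<eta> unfolding \<phi>_def by (intro exI[of _ g] exI[of _ \<eta>]) simp
qed

end

subsection \<open>Completing the new derivations to a basis\<close>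

context module
begin

text \<open>Equal members at different indices would give a relation with coefficients 1 and -1, so
  injectivity comes along with independence. This serves both vectors over the field and operators
  over \<open>S\<close>.\<close>

lemma family_independent:
  assumes "finite I" and zero: "\<And>u. (\<Sum>i\<in>I. scale (u i) (f i)) = 0 \<Longrightarrow> \<forall>i\<in>I. u i = 0"
  shows "inj_on f I \<and> independent (f ` I)"
proof
  show inj: "inj_on f I"
  proof (rule inj_onI, rule ccontr)
    fix i j assume ij: "i \<in> I" "j \<in> I" "f i = f j" "i \<noteq> j"
    let ?u = "\<lambda>k. if k = i then 1 else if k = j then - 1 else 0 :: 'a"
    have "(\<Sum>k\<in>I. scale (?u k) (f k)) = (\<Sum>k\<in>{i, j}. scale (?u k) (f k))"
      by (rule sum.mono_neutral_right) (use ij assms(1) in auto)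
    also have "\<dots> = 0" using ij by simp
    finally have "\<forall>k\<in>I. ?u k = 0" by (rule zero[of ?u])
    from bspec[OF this ij(1)] show False by simp
  qed
  show "independent (f ` I)"
  proof
    assume "dependent (f ` I)"
    then obtain u v where u: "v \<in> f ` I" "u v \<noteq> 0" "(\<Sum>v\<in>f ` I. scale (u v) v) = 0"
      using assms(1) by (auto simp: dependent_finite)
    then have "(\<Sum>i\<in>I. scale (u (f i)) (f i)) = 0" by (simp add: sum.reindex[OF inj])
    then have "\<forall>i\<in>I. u (f i) = 0" by (rule zero)
    then show False using u by auto
  qed
qed

end

lemma det_nonzero_of_independent_rows:
  fixes W :: "'a::field ^ 'n ^ 'n"
  assumes "inj (($) W)" "vec.independent (range (($) W))"
  shows "det W \<noteq> 0"
proof -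
  have "\<forall>i. c i = 0" if "(\<Sum>i\<in>UNIV. c i *s row i W) = 0" for c
  proof
    fix i
    have "(\<Sum>v\<in>range (($) W). c (inv (($) W) v) *s v) = 0"
      using that by (simp add: sum.reindex[OF assms(1)] inv_f_f[OF assms(1)] row_def)
    then have "c (inv (($) W) (W $ i)) = 0"
      using assms(2) by (intro vec.independentD[where v = "W $ i"]) auto
    then show "c i = 0" by (simp add: inv_f_f[OF assms(1)])
  qed
  then obtain B where "W ** B = mat 1" using matrix_right_invertible_independent_rows[of W] by auto
  then have "det W * det B = 1" by (metis det_I det_mul)
  then show ?thesis by auto
qed

text \<open>By Steinitz exchange. That \<open>\<tau>\<close> moves an index only into \<open>R\<close> is what later bounds the degree of
  the transition determinant.\<close>

lemma exchange_standard_basis: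
  fixes w :: "'n::finite \<Rightarrow> 'a::field ^ 'n"
  assumes "inj_on w R" "vec.independent (w ` R)"
  obtains \<tau> where "\<And>r. r \<notin> R \<Longrightarrow> axis (\<tau> r) 1 \<notin> w ` R"
    "\<And>r. r \<notin> R \<Longrightarrow> \<tau> r \<in> R \<or> \<tau> r = r"
    "det (\<chi> r. if r \<in> R then w r else axis (\<tau> r) 1) \<noteq> 0"
proof -
  obtain B where B: "w ` R \<subseteq> B" "B \<subseteq> w ` R \<union> range (\<lambda>i. axis i 1)" "vec.independent B"
    "w ` R \<union> range (\<lambda>i. axis i 1) \<subseteq> vec.span B"
    using vec.maximal_independent_subset_extend[of "w ` R" "w ` R \<union> range (\<lambda>i. axis i 1)"] assms(2)
    by auto
  \<comment> \<open>Indices of the unit vectors added to complete the given vectors to the basis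
    \<open>B\<close>.\<close>
  define J where "J = {i. axis i 1 \<in> B - w ` R}"
  have BJ: "B = w ` R \<union> (\<lambda>i. axis i 1) ` J" using B(1,2) by (auto simp: J_def)
  have inj_axis: "inj_on (\<lambda>i. axis i (1::'a)) X" for X :: "'n set"
    by (auto simp: inj_on_def axis_eq_axis)
  have "finite B" using B(3) by (rule vec.finiteI_independent)
  have "vec.span B = UNIV"
  proof -
    have "f \<in> vec.span B" for f
    proof -
      have "f = (\<Sum>i\<in>UNIV. f $ i *s axis i 1)"
        by (simp add: vec_eq_iff axis_def if_distrib[of "\<lambda>t. _ * t"] cong: if_cong)
      also have "\<dots> \<in> vec.span B" using B(4) by (intro vec.span_sum vec.span_scale) auto
      finally show ?thesis .
    qed
    then show ?thesis by auto
  qed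
  then have "card B = CARD('n)"
    using vec.dim_span_eq_card_independent[OF B(3)] by (simp add: vec.dim_UNIV card_cart_basis)
  moreover have "y \<notin> w ` R" if y: "y \<in> (\<lambda>i. axis i 1) ` J" for y
  proof -
    obtain i where i: "y = axis i 1" "i \<in> J" using y by (rule imageE)
    then show ?thesis by (simp add: J_def)
  qed
  then have "w ` R \<inter> (\<lambda>i. axis i 1) ` J = {}" by blast
  then have "card B = card R + card J"
    unfolding BJ by (simp add: card_Un_disjoint card_image[OF assms(1)] card_image[OF inj_axis])
  ultimately have "card J = card (- R)" by (simp add: Compl_eq_Diff_UNIV card_Diff_subset)
  then have "card (- R - J) = card (J - - R)"
    using card_Diff_subset_Int[of "- R" J] card_Diff_subset_Int[of J "- R"]
    by (simp add: Int_commute del: Diff_Compl)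
  \<comment> \<open>Rows outside \<open>R\<close> whose own unit vector was not added receive the
    added unit vectors with index in \<open>R\<close>; there are equally many of both.\<close>
  then obtain \<sigma> where \<sigma>: "bij_betw \<sigma> (- R - J) (J - - R)"
    using finite_same_card_bij[of "- R - J" "J - - R"] by auto
  define \<tau> where "\<tau> r = (if r \<in> J then r else \<sigma> r)" for r
  have \<sigma>_mem: "\<sigma> r \<in> J \<inter> R" if "r \<notin> R" "r \<notin> J" for r
    using bij_betwE[OF \<sigma>] that by auto
  have \<tau>_J: "\<tau> r \<in> J" if "r \<notin> R" for r using \<sigma>_mem that by (auto simp: \<tau>_def)
  have inj: "inj_on \<tau> (- R)"
  proof (rule inj_onI)
    fix r s assume "r \<in> - R" "s \<in> - R" "\<tau> r = \<tau> s"
    then show "r = s"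
      using inj_onD[OF bij_betw_imp_inj_on[OF \<sigma>], of r s] \<sigma>_mem[of r] \<sigma>_mem[of s]
      by (cases "r \<in> J"; cases "s \<in> J") (auto simp: \<tau>_def)
  qed
  show thesis
  proof
    show "\<tau> r \<in> R \<or> \<tau> r = r" if "r \<notin> R" for r using \<sigma>_mem that by (auto simp: \<tau>_def)
    show new: "axis (\<tau> r) 1 \<notin> w ` R" if "r \<notin> R" for r using \<tau>_J[OF that] by (simp add: J_def)
    let ?W = "\<chi> r. if r \<in> R then w r else axis (\<tau> r) 1"
    have "range (($) ?W) \<subseteq> B" using B(1) \<tau>_J by (auto simp: J_def)
    then have "vec.independent (range (($) ?W))" using B(3) vec.independent_mono by blast
    moreover have "inj (($) ?W)"
    proof (rule injI)
      fix r s assume "?W $ r = ?W $ s"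
      then show "r = s"
        using inj_onD[OF assms(1), of r s] inj_onD[OF inj, of r s] new[of r] new[of s]
        by (cases "r \<in> R"; cases "s \<in> R") (auto simp: axis_eq_axis image_iff)
    qed
    ultimately show "det ?W \<noteq> 0" by (intro det_nonzero_of_independent_rows)
  qed
qed

text \<open>By \<open>det_T\<close> the rows of \<open>T\<close> are a basis of the logarithmic
  module; \<open>e\<close> stands for their exponents. Each index \<open>r\<close> in
  \<open>R\<close> is matched with a hyperplane \<open>h r\<close>, and \<open>g\<close>,
  \<open>\<eta>\<close> come from \<open>relation_modulo_form\<close>; the degree
  \<open>e r - e i\<close> encodes the condition on the size of the restriction.\<close>

locale simultaneous_relations = linear_forms A b
  for A :: "'h set" and b :: "'h \<Rightarrow> 'a::field ^ 'n::finite" +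
  fixes T :: "('a, 'n) coord_ring ^ 'n ^ 'n" and c :: 'a and e :: "'n \<Rightarrow> int" and i\<^sub>0 :: 'n
    and R :: "'n set" and h :: "'n \<Rightarrow> 'h" and g :: "'n \<Rightarrow> 'n \<Rightarrow> ('a, 'n) coord_ring"
    and \<eta> :: "'n \<Rightarrow> ('a, 'n) coord_ring ^ 'n" and x :: "'a ^ 'n"
  assumes T: "T $ r \<in> log_vecs" and det_T: "det T = const_poly c * Q" "c \<noteq> 0"
    and euler_row: "T $ i\<^sub>0 = (\<chi> k. var k)"
    and h: "inj_on h R" "h ` R \<subseteq> A"
    and x_nonzero: "x \<noteq> 0" and x_mem: "r \<in> R \<Longrightarrow> cdot (b (h r)) x = 0"
    and i\<^sub>0_notin: "i\<^sub>0 \<notin> R"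
    and deg_g: "r \<in> R \<Longrightarrow> hdeg (g r i) (e r - e i)"
    and relation: "r \<in> R \<Longrightarrow> (\<Sum>i\<in>UNIV. g r i *s T $ i) = lin (b (h r)) *s \<eta> r"
    and \<eta>_at_x: "r \<in> R \<Longrightarrow> eval_at x (pair (b (h r)) (\<eta> r)) \<noteq> 0"
    and e_le: "i \<in> R \<Longrightarrow> j \<notin> R \<Longrightarrow> j \<noteq> i\<^sub>0 \<Longrightarrow> e i \<le> e j"
begin

text \<open>The product of \<open>lin (b (h r))\<close> and \<open>\<eta> r\<close> is logarithmic
  by \<open>relation\<close>, and the prime form of another hyperplane does not divide the first
  factor.\<close>

lemma form_dvd_pair_\<eta>:
  assumes "r \<in> R" "K \<in> A" "K \<noteq> h r" shows "lin (b K) dvd pair (b K) (\<eta> r)"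
proof -
  have "(\<Sum>i\<in>UNIV. g r i *s T $ i) \<in> log_vecs" by (intro log_vecs_sum log_vecs_scale T)
  then have "lin (b K) dvd lin (b (h r)) * pair (b K) (\<eta> r)"
    using assms(2) by (simp add: relation[OF assms(1)] log_vecs_def pair_scale)
  moreover have "\<not> lin (b K) dvd lin (b (h r))"
    using assms h(2) by (intro not_dvd) auto
  ultimately show ?thesis using prime_form[OF assms(2)] prime_elem_dvd_multD by blast
qed

text \<open>The coefficients, in the rows of \<open>T\<close>, of the Euler derivation and of the
  multiples \<open>lin (b (h r)) *s \<eta> r\<close>.\<close>

definition rows :: "'n \<Rightarrow> ('a, 'n) coord_ring ^ 'n" where
  "rows r = (if r = i\<^sub>0 then axis i\<^sub>0 1 else (\<chi> i. g r i))"

definition rows_at_x :: "'n \<Rightarrow> 'a ^ 'n" where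
  "rows_at_x r = (\<chi> i. eval_at x (rows r $ i))"

text \<open>In a relation \<open>\<Sum> a\<^sub>i \<theta>\<^sub>i = \<Sum> d\<^sub>r b\<^sub>r \<eta>\<^sub>r\<close> whose coefficients on the left vanish at \<open>x\<close>
  apart from that of the Euler derivation, evaluation at \<open>x\<close> kills the latter too.
  Then apply both sides to \<open>b\<^sub>r\<close>, divide by \<open>b\<^sub>r\<close> and evaluate at \<open>x\<close>.\<close>

lemma rows_at_x_independent:
  assumes zero: "(\<Sum>r\<in>insert i\<^sub>0 R. d r *s rows_at_x r) = 0"
  shows "\<forall>r\<in>insert i\<^sub>0 R. d r = 0"
proof -
  define a where "a i = (\<Sum>r\<in>R. const_poly (d r) * g r i)" for i
  define \<psi> where "\<psi> = (\<Sum>i\<in>UNIV. a i *s T $ i)"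
  have "finite R" by simp
  have a_at_x: "eval_at x (a i) = - (if i = i\<^sub>0 then d i\<^sub>0 else 0)" for i
  proof -
    have "(\<Sum>r\<in>insert i\<^sub>0 R. d r * rows_at_x r $ i) = 0"
      using arg_cong[OF zero, of "\<lambda>f. f $ i"] by (simp add: sum.insert[OF \<open>finite R\<close> i\<^sub>0_notin])
    then have "d i\<^sub>0 * rows_at_x i\<^sub>0 $ i + (\<Sum>r\<in>R. d r * rows_at_x r $ i) = 0"
      by (simp add: sum.insert[OF \<open>finite R\<close> i\<^sub>0_notin])
    moreover have "rows_at_x i\<^sub>0 $ i = (if i = i\<^sub>0 then 1 else 0)"
      by (simp add: rows_at_x_def rows_def axis_def)
    moreover have "(\<Sum>r\<in>R. d r * rows_at_x r $ i) = eval_at x (a i)"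
      unfolding a_def eval_at_sum eval_at_mult
      by (rule sum.cong) (use i\<^sub>0_notin in \<open>auto simp: rows_at_x_def rows_def\<close>)
    ultimately show ?thesis by (auto simp: add_eq_0_iff)
  qed
  have \<psi>: "\<psi> = (\<Sum>r\<in>R. const_poly (d r) *s (lin (b (h r)) *s \<eta> r))"
  proof -
    have "\<psi> $ k = (\<Sum>r\<in>R. const_poly (d r) * (\<Sum>i\<in>UNIV. g r i *s T $ i) $ k)" for k
      by (simp add: \<psi>_def a_def sum_distrib_left sum_distrib_right mult.assoc)
        (rule sum.swap)
    also have "\<And>k. (\<Sum>r\<in>R. const_poly (d r) * (\<Sum>i\<in>UNIV. g r i *s T $ i) $ k) =
        (\<Sum>r\<in>R. const_poly (d r) * (lin (b (h r)) *s \<eta> r) $ k)"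
      by (rule sum.cong) (simp_all only: relation)
    finally show ?thesis by (simp add: vec_eq_iff mult.assoc)
  qed
  obtain k where k: "x $ k \<noteq> 0" using x_nonzero by (auto simp: vec_eq_iff)
  \<comment> \<open>At \<open>x\<close> all forms \<open>b (h r)\<close> vanish, while the Euler row
    takes the value \<open>x\<close>, whose entry \<open>k\<close> is not 0.\<close>
  have "eval_at x (\<psi> $ k) = 0"
    using x_mem by (simp add: \<psi> eval_at_sum eval_at_mult)
  moreover have "eval_at x (\<psi> $ k) = - (d i\<^sub>0 * x $ k)"
    by (simp add: \<psi>_def eval_at_sum eval_at_mult a_at_x euler_row
        if_distrib[of "\<lambda>t. t * _"] if_distrib[of uminus] cong: if_cong)
  ultimately have d_i\<^sub>0: "d i\<^sub>0 = 0" using k by simp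
  then have a_at_x: "eval_at x (a i) = 0" for i using a_at_x[of i] by simp
  have "d r = 0" if r: "r \<in> R" for r
  proof -
    let ?\<alpha> = "lin (b (h r))"
    have hr: "h r \<in> A" using h(2) r by auto
    have "?\<alpha> dvd pair (b (h r)) (T $ i)" for i using T hr by (simp add: log_vecs_def)
    then obtain t where t: "\<And>i. pair (b (h r)) (T $ i) = ?\<alpha> * t i" unfolding dvd_def by metis
    \<comment> \<open>For \<open>s\<close> other than \<open>r\<close> the vector
      \<open>\<eta> s\<close> is logarithmic along \<open>h r\<close>. So after division by
      \<open>?\<alpha>\<close> its term still carries the factor \<open>lin (b (h s))\<close>, which
      vanishes at \<open>x\<close>.\<close>
    have "?\<alpha> dvd pair (b (h r)) (\<eta> s)" if "s \<in> R - {r}" for s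
      using that r hr inj_onD[OF h(1), of r s] by (intro form_dvd_pair_\<eta>) auto
    then obtain y where y: "\<And>s. s \<in> R - {r} \<Longrightarrow> pair (b (h r)) (\<eta> s) = ?\<alpha> * y s"
      unfolding dvd_def by metis
    have "?\<alpha> * (\<Sum>i\<in>UNIV. a i * t i) = pair (b (h r)) \<psi>"
      by (simp add: \<psi>_def pair_sum pair_scale t sum_distrib_left algebra_simps)
    also have "\<dots> = const_poly (d r) * (?\<alpha> * pair (b (h r)) (\<eta> r)) +
        (\<Sum>s\<in>R - {r}. const_poly (d s) * (lin (b (h s)) * pair (b (h r)) (\<eta> s)))"
      by (simp add: \<psi> pair_sum pair_add pair_scale mult.assoc sum.remove[OF \<open>finite R\<close> r])
    also have "(\<Sum>s\<in>R - {r}. const_poly (d s) * (lin (b (h s)) * pair (b (h r)) (\<eta> s))) =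
        (\<Sum>s\<in>R - {r}. const_poly (d s) * (lin (b (h s)) * (?\<alpha> * y s)))"
      by (rule sum.cong) (simp_all only: y)
    finally have "?\<alpha> * (\<Sum>i\<in>UNIV. a i * t i) = ?\<alpha> * (const_poly (d r) * pair (b (h r)) (\<eta> r) +
        (\<Sum>s\<in>R - {r}. const_poly (d s) * (lin (b (h s)) * y s)))"
      by (simp add: sum_distrib_left algebra_simps)
    then have "(\<Sum>i\<in>UNIV. a i * t i) = const_poly (d r) * pair (b (h r)) (\<eta> r) +
        (\<Sum>s\<in>R - {r}. const_poly (d s) * (lin (b (h s)) * y s))"
      by (rule coord_ring_mult_left_cancel) (use nonzero[OF hr] in simp)
    then have "eval_at x (\<Sum>i\<in>UNIV. a i * t i) = eval_at x (const_poly (d r) * pair (b (h r)) (\<eta> r) +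
        (\<Sum>s\<in>R - {r}. const_poly (d s) * (lin (b (h s)) * y s)))"
      by (rule arg_cong)
    then have "d r * eval_at x (pair (b (h r)) (\<eta> r)) = 0"
      using x_mem by (simp add: eval_at_sum eval_at_mult eval_at_add a_at_x)
    then show ?thesis using \<eta>_at_x[OF r] by simp
  qed
  then show ?thesis using d_i\<^sub>0 by simp
qed

text \<open>The transition matrix has homogeneous entries. Its determinant has degree at most 0, because the
  exponents indexed by \<open>R\<close> are the smallest ones, and it does not vanish at \<open>x\<close>: it is a nonzero
  constant, which also forces the exchanged exponents to be equal.\<close>

lemma new_basis:
  obtains \<tau> F c' where "c' \<noteq> 0" "det F = const_poly c' * Q" "\<And>r. F $ r \<in> log_vecs"
    "F $ i\<^sub>0 = (\<chi> k. var k)" "\<And>r. r \<in> R \<Longrightarrow> F $ r = lin (b (h r)) *s \<eta> r"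
    "\<And>r. r \<notin> R \<Longrightarrow> r \<noteq> i\<^sub>0 \<Longrightarrow> F $ r = T $ \<tau> r \<and> e (\<tau> r) = e r"
proof -
  let ?R = "insert i\<^sub>0 R"
  have "inj_on rows_at_x ?R \<and> vec.independent (rows_at_x ` ?R)"
    by (rule vec.family_independent) (use rows_at_x_independent in auto)
  from conjunct1[OF this] conjunct2[OF this]
  obtain \<tau> where \<tau>: "\<And>r. r \<notin> ?R \<Longrightarrow> axis (\<tau> r) 1 \<notin> rows_at_x ` ?R"
    "\<And>r. r \<notin> ?R \<Longrightarrow> \<tau> r \<in> ?R \<or> \<tau> r = r"
    "det (\<chi> r. if r \<in> ?R then rows_at_x r else axis (\<tau> r) 1) \<noteq> 0"
    by (rule exchange_standard_basis) blast
  define N where "N = (\<chi> r. if r \<in> ?R then rows r else axis (\<tau> r) 1)"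
  define \<epsilon> where "\<epsilon> r = (if r \<in> ?R then e r else e (\<tau> r))" for r
  have "(\<chi> i j. eval_at x (N $ i $ j)) = (\<chi> r. if r \<in> ?R then rows_at_x r else axis (\<tau> r) 1)"
    by (auto simp: vec_eq_iff N_def rows_at_x_def axis_def)
  then have N_at_x: "eval_at x (det N) \<noteq> 0" using \<tau>(3) by (simp add: eval_at_det)
  have deg_N: "hdeg (N $ r $ i) (\<epsilon> r - e i)" for r i
    using deg_g[of r i] by (auto simp: N_def \<epsilon>_def rows_def axis_def)
  \<comment> \<open>An exchanged index \<open>\<tau> r\<close> cannot be \<open>i\<^sub>0\<close>,
    whose unit vector is already a row; it lies in \<open>R\<close>, where the exponents are at most
    \<open>e r\<close>.\<close>
  have \<epsilon>_le: "\<epsilon> r \<le> e r" for r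
  proof (cases "r \<in> ?R \<or> \<tau> r = r")
    case False
    then have "\<tau> r \<in> ?R" using \<tau>(2) by blast
    moreover have "\<tau> r \<noteq> i\<^sub>0"
    proof
      assume "\<tau> r = i\<^sub>0"
      moreover have "rows_at_x i\<^sub>0 = axis i\<^sub>0 1"
        by (simp add: vec_eq_iff rows_at_x_def rows_def axis_def)
      ultimately show False using \<tau>(1)[of r] False by (metis image_eqI insertI1)
    qed
    ultimately show ?thesis using False e_le by (auto simp: \<epsilon>_def)
  qed (auto simp: \<epsilon>_def)
  have deg_det: "hdeg (det N) (sum \<epsilon> UNIV - sum e UNIV)"
    by (rule hdeg_det) (rule deg_N)
  have "det N \<noteq> 0" using N_at_x by auto
  \<comment> \<open>A nonzero determinant has nonnegative degree, while \<open>\<epsilon>_le\<close>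
    makes it at most 0; hence every exponent is preserved.\<close>
  with deg_det have "0 \<le> sum \<epsilon> UNIV - sum e UNIV" by (rule hdeg_nonneg)
  moreover have "sum \<epsilon> UNIV \<le> sum e UNIV" by (rule sum_mono) (rule \<epsilon>_le)
  ultimately have sum_eq: "sum \<epsilon> UNIV = sum e UNIV" by simp
  have \<epsilon>: "\<epsilon> r = e r" for r
  proof (rule ccontr)
    assume "\<epsilon> r \<noteq> e r"
    then have "\<epsilon> r < e r" using \<epsilon>_le[of r] by simp
    then have "sum \<epsilon> UNIV < sum e UNIV"
      using \<epsilon>_le by (intro sum_strict_mono_ex1) auto
    then show False using sum_eq by simp
  qed
  obtain c\<^sub>N where c\<^sub>N: "det N = const_poly c\<^sub>N"
    using hdeg_0_imp_const[of "det N"] deg_det sum_eq by auto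
  then have "c\<^sub>N \<noteq> 0" using N_at_x by auto
  define F where "F = N ** T"
  have F_row: "F $ r = (\<Sum>i\<in>UNIV. N $ r $ i *s T $ i)" for r
    by (simp add: F_def vec_eq_iff matrix_matrix_mult_def)
  have axis_row: "(\<Sum>i\<in>UNIV. axis j 1 $ i *s T $ i) = T $ j" for j
    by (simp add: axis_def if_distrib[of "\<lambda>t. t *s _"] cong: if_cong)
  show thesis
  proof (rule that[of "c\<^sub>N * c" F \<tau>])
    show "c\<^sub>N * c \<noteq> 0" using \<open>c\<^sub>N \<noteq> 0\<close> det_T(2) by simp
    show "det F = const_poly (c\<^sub>N * c) * Q"
      by (simp add: F_def det_mul c\<^sub>N det_T(1) const_poly_mult mult.assoc)
    show "F $ r \<in> log_vecs" for r
      unfolding F_row by (intro log_vecs_sum log_vecs_scale T)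
    show "F $ i\<^sub>0 = (\<chi> k. var k)"
      by (simp add: F_row N_def rows_def axis_row euler_row)
    show "F $ r = lin (b (h r)) *s \<eta> r" if "r \<in> R" for r
      using that i\<^sub>0_notin by (auto simp: F_row N_def rows_def simp flip: relation)
    show "F $ r = T $ \<tau> r \<and> e (\<tau> r) = e r" if "r \<notin> R" "r \<noteq> i\<^sub>0" for r
      using that \<epsilon>[of r] by (simp add: F_row N_def axis_row \<epsilon>_def)
  qed
qed

end

section \<open>Passing to the deletion\<close>

context simultaneous_relations
begin

lemma linear_forms_deletion: "linear_forms (A - h ` R) b"
  by unfold_locales (use finite_A nonzero not_dvd in auto)

text \<open>\<open>\<eta> r\<close> is logarithmic along every hyperplane except possibly
  \<open>h r\<close>, which is removed. Taking \<open>lin (b (h r))\<close> out of each row indexed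
  by \<open>R\<close> divides the determinant by exactly the forms lost from
  \<open>Q\<close>.\<close>

lemma deletion_rows:
  assumes "\<And>r. F $ r \<in> log_vecs" "\<And>r. r \<in> R \<Longrightarrow> F $ r = lin (b (h r)) *s \<eta> r"
    and "det F = const_poly c' * Q"
  defines "F' \<equiv> \<chi> r. if r \<in> R then \<eta> r else F $ r"
  shows "F' $ r \<in> linear_forms.log_vecs (A - h ` R) b"
    and "det F' = const_poly c' * linear_forms.Q (A - h ` R) b"
proof -
  interpret deletion: linear_forms "A - h ` R" b by (rule linear_forms_deletion)
  show "F' $ r \<in> deletion.log_vecs"
    using assms(1)[of r] form_dvd_pair_\<eta>[of r]
    by (auto simp: F'_def deletion.log_vecs_def log_vecs_def)
  let ?P = "\<Prod>K\<in>h ` R. lin (b K)"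
  have P_nonzero: "?P \<noteq> 0"
    using nonzero h(2) finite_A by (subst coord_ring_prod_eq_0_iff) auto
  have "F = (\<chi> r. (if r \<in> R then lin (b (h r)) else 1) *s F' $ r)"
    using assms(2) by (simp add: vec_eq_iff F'_def)
  then have "det F = (\<Prod>r\<in>UNIV. if r \<in> R then lin (b (h r)) else 1) * det F'"
    using det_rows_mul[of "\<lambda>r. if r \<in> R then lin (b (h r)) else 1" "\<lambda>r. F' $ r"] by simp
  also have "(\<Prod>r\<in>UNIV. if r \<in> R then lin (b (h r)) else 1) = ?P"
    by (simp add: prod.If_cases prod.reindex[OF h(1)])
  finally have "?P * det F' = const_poly c' * Q" using assms(3) by simp
  also have "Q = ?P * deletion.Q"
    unfolding Q_def deletion.Q_def using prod.subset_diff[OF h(2) finite_A] by (simp add: mult.commute)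
  finally have "?P * det F' = ?P * (const_poly c' * deletion.Q)" by (simp add: algebra_simps)
  then show "det F' = const_poly c' * deletion.Q"
    using P_nonzero by (rule coord_ring_mult_left_cancel)
qed

end

subsection \<open>Derivations as coefficient vectors\<close>

definition coeffs :: "('a::field ^ 'n::finite \<Rightarrow> 'a) \<Rightarrow> 'a ^ 'n" where
  "coeffs \<beta> = (\<chi> i. \<beta> (axis i 1))"

lemma form_poly_eq_lin: "form_poly \<beta> = lin (coeffs \<beta>)"
  by (simp add: form_poly_def lin_def coeffs_def)

lemma dual_space_eq_cdot:
  assumes "\<beta> \<in> dual_space" shows "\<beta> v = cdot (coeffs \<beta>) v"
proof -
  interpret Vector_Spaces.linear "(*s)" "(*)" \<beta> using assms by (simp add: dual_space_def)
  have "v = (\<Sum>i\<in>UNIV. v $ i *s axis i 1)"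
    by (simp add: vec_eq_iff axis_def if_distrib[of "\<lambda>t. _ * t"] cong: if_cong)
  then have "\<beta> v = \<beta> (\<Sum>i\<in>UNIV. v $ i *s axis i 1)" by simp
  then show ?thesis by (simp add: sum scale cdot_def coeffs_def mult.commute)
qed

text \<open>Logarithmic and homogeneous derivations are defined through values on linear forms, so
  evaluating operators reduces to this case.\<close>

lemma partial_deriv_lin:
  fixes a :: "'a::field ^ 'n::finite"
  shows "partial_deriv i (lin a) = const_poly (a $ i)"
proof -
  have lin: "lin a = (\<Sum>j\<in>UNIV. Poly_Mapping.single (Poly_Mapping.single j 1) (a $ j))"
    by (simp add: lin_def const_poly_def var_def mult_single)
  let ?D = "\<lambda>m. Poly_Mapping.single (m - Poly_Mapping.single i 1)
    (of_nat (Poly_Mapping.lookup m i) * Poly_Mapping.lookup (lin a) m)"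
  have inj: "inj (\<lambda>j::'n. Poly_Mapping.single j (1::nat))"
  proof (rule injI)
    fix j k :: 'n assume "Poly_Mapping.single j (1::nat) = Poly_Mapping.single k 1"
    then have "Poly_Mapping.lookup (Poly_Mapping.single j (1::nat)) k = 1" by simp
    then show "j = k" by (simp add: lookup_single when_def split: if_splits)
  qed
  have "Poly_Mapping.keys (lin a) \<subseteq> range (\<lambda>j. Poly_Mapping.single j 1)"
  proof
    fix m assume "m \<in> Poly_Mapping.keys (lin a)"
    then have "(\<Sum>j\<in>UNIV. Poly_Mapping.lookup (Poly_Mapping.single (Poly_Mapping.single j 1) (a $ j)) m) \<noteq> 0"
      by (simp add: in_keys_iff lin lookup_sum)
    then obtain j where "Poly_Mapping.lookup (Poly_Mapping.single (Poly_Mapping.single j 1) (a $ j)) m \<noteq> 0"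
      by (rule sum.not_neutral_contains_not_neutral)
    then show "m \<in> range (\<lambda>j. Poly_Mapping.single j 1)"
      by (auto simp: lookup_single when_def split: if_splits)
  qed
  then have "partial_deriv i (lin a) = sum ?D (range (\<lambda>j. Poly_Mapping.single j 1))"
    unfolding partial_deriv_def by (intro sum.mono_neutral_left) (auto simp: in_keys_iff)
  also have "\<dots> = (\<Sum>j\<in>UNIV. ?D (Poly_Mapping.single j 1))"
    unfolding sum.reindex[OF inj] o_def ..
  also have "\<dots> = (\<Sum>j\<in>UNIV. if j = i then const_poly (a $ i) else 0)"
    by (rule sum.cong) (auto simp: lookup_single when_def const_poly_def lookup_lin[simplified])
  finally show ?thesis by simp
qed

definition der :: "('a::field, 'n::finite) coord_ring ^ 'n \<Rightarrow> ('a, 'n) operator" where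
  "der f = (\<Sum>i\<in>UNIV. f $ i *\<^sub>S partial_deriv i)"

lemma sum_operator_apply: "(\<Sum>i\<in>I. (\<theta> i :: ('a::field, 'n::finite) operator)) p = (\<Sum>i\<in>I. \<theta> i p)"
  by (induction I rule: infinite_finite_induct) auto

lemma der_lin: "der f (lin a) = pair a f"
  by (simp add: der_def sum_operator_apply op_scale_def partial_deriv_lin pair_def mult.commute)

lemma lin_axis: "lin (axis k 1) = var k"
  by (simp add: lin_def axis_def if_distrib[of const_poly] if_distrib[of "\<lambda>t. t * _"] cong: if_cong)

lemma pair_axis: "pair (axis k 1) f = f $ k"
  by (simp add: pair_def axis_def if_distrib[of const_poly] if_distrib[of "\<lambda>t. t * _"] cong: if_cong)

text \<open>The coefficient vector is recovered by applying the operator to the variables.\<close>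

lemma der_eq_iff [simp]: "der f = der f' \<longleftrightarrow> f = f'"
  by (metis der_lin pair_axis vec_eq_iff)

lemma der_add: "der (f + f') = der f + der f'"
  and der_scale: "der (p *s f) = p *\<^sub>S der f"
  by (simp_all add: der_def op.scale_left_distrib sum.distrib op.scale_sum_right)

lemma der_zero [simp]: "der 0 = 0"
  by (simp add: der_def)

lemma der_sum: "der (sum f I) = (\<Sum>i\<in>I. der (f i))"
  by (induction I rule: infinite_finite_induct) (auto simp: der_add)

lemma der_axis: "der (axis i 1) = partial_deriv i"
proof -
  have "der (axis i 1) = (\<Sum>j\<in>UNIV. if j = i then partial_deriv i else 0)"
    unfolding der_def by (rule sum.cong) (auto simp: axis_def)
  then show ?thesis by simp
qed

lemma euler_eq_der: "euler = der (\<chi> k. var k)"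
  by (simp add: euler_def der_def)

lemma Der_eq_range_der: "Der = range der"
proof
  have "op.subspace (range der)"
    by (auto simp: op.subspace_def image_iff simp flip: der_add der_scale intro: exI[of _ 0])
  moreover have "range partial_deriv \<subseteq> range der"
    by (metis der_axis image_subsetI rangeI)
  ultimately show "Der \<subseteq> range der" unfolding Der_def by (intro op.span_minimal)
  show "range der \<subseteq> Der"
    unfolding Der_def der_def by (auto intro!: op.span_sum op.span_scale intro: op.span_base)
qed

text \<open>Coordinate functions pick out the coefficients; conversely the value on a form combines
  the coefficients with constant weights.\<close>

lemma homogeneous_der_iff:
  fixes f :: "('a::field, 'n::finite) coord_ring ^ 'n"
  shows "homogeneous_der (der f) d \<longleftrightarrow> (\<forall>k. hdeg (f $ k) (int d))"
proof
  assume *: "homogeneous_der (der f) d"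
  show "\<forall>k. hdeg (f $ k) (int d)"
  proof
    fix k
    let ?x = "\<lambda>v :: 'a ^ 'n. v $ k"
    have "?x \<in> dual_space"
      unfolding dual_space_def mem_Collect_eq
      by unfold_locales (auto simp: algebra_simps)
    moreover have "coeffs ?x = axis k 1"
      by (simp add: coeffs_def vec_eq_iff axis_def)
    then have "der f (form_poly ?x) = f $ k"
      by (simp add: form_poly_eq_lin der_lin pair_axis)
    ultimately show "hdeg (f $ k) (int d)"
      using * unfolding homogeneous_der_def homogeneous_poly_iff_hdeg by fastforce
  qed
next
  assume "\<forall>k. hdeg (f $ k) (int d)"
  then show "homogeneous_der (der f) d"
    unfolding homogeneous_der_def homogeneous_poly_iff_hdeg form_poly_eq_lin der_lin
    by (auto intro: hdeg_pair)
qed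

section \<open>Bases of operators and determinants of coefficient vectors\<close>

context linear_forms
begin

lemma spanning_of_basis_family:
  assumes "basis_family I (\<lambda>i. der (t i)) (der ` log_vecs)" "finite I"
  shows "i \<in> I \<Longrightarrow> t i \<in> log_vecs"
    and "f \<in> log_vecs \<Longrightarrow> \<exists>u. f = (\<Sum>i\<in>I. u i *s t i)"
proof -
  have inj: "inj_on (\<lambda>i. der (t i)) I" and span: "op.span ((\<lambda>i. der (t i)) ` I) = der ` log_vecs"
    using assms(1) by (auto simp: basis_family_def)
  show "t i \<in> log_vecs" if "i \<in> I"
  proof -
    have "der (t i) \<in> der ` log_vecs" using that by (auto simp flip: span intro: op.span_base)
    then show ?thesis by auto
  qed
  show "\<exists>u. f = (\<Sum>i\<in>I. u i *s t i)" if "f \<in> log_vecs"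
  proof -
    have "der f \<in> op.span ((\<lambda>i. der (t i)) ` I)" using that span by auto
    then obtain u where "der f = (\<Sum>\<theta>\<in>(\<lambda>i. der (t i)) ` I. u \<theta> *\<^sub>S \<theta>)"
      using assms(2) by (auto simp: op.span_finite)
    also have "\<dots> = der (\<Sum>i\<in>I. u (der (t i)) *s t i)"
      by (simp add: sum.reindex[OF inj] der_sum der_scale)
    finally show ?thesis by auto
  qed
qed

text \<open>A nonzero determinant gives independence, Saito's criterion gives the span. The
  bijection \<open>\<rho>\<close> translates the index set of a basis into row indices.\<close>

lemma basis_family_of_det:
  fixes \<rho> :: "'i \<Rightarrow> 'n"
  assumes \<rho>: "bij_betw \<rho> I UNIV"
    and F: "\<And>r. F $ r \<in> log_vecs" "det F = const_poly c * Q" "c \<noteq> 0"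
  shows "basis_family I (\<lambda>i. der (F $ \<rho> i)) (der ` log_vecs)"
proof -
  have "finite I" using \<rho> by (metis bij_betw_finite finite)
  have "det F \<noteq> 0" using F(2,3) Q_nonzero by (simp add: coord_ring_mult_eq_0_iff)
  have reindex: "(\<Sum>i\<in>I. y (\<rho> i)) = (\<Sum>r\<in>UNIV. y r)" for y :: "'n \<Rightarrow> ('a, 'n) coord_ring ^ 'n"
    by (rule sum.reindex_bij_betw[OF \<rho>])
  have "inj_on (\<lambda>i. der (F $ \<rho> i)) I \<and> op.independent ((\<lambda>i. der (F $ \<rho> i)) ` I)"
  proof (rule op.family_independent[OF \<open>finite I\<close>])
    fix u assume "(\<Sum>i\<in>I. u i *\<^sub>S der (F $ \<rho> i)) = 0"
    then have "der (\<Sum>i\<in>I. u i *s F $ \<rho> i) = der 0" by (simp add: der_sum der_scale)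
    then have "(\<Sum>i\<in>I. u i *s F $ \<rho> i) = 0" by (simp only: der_eq_iff)
    also have "(\<Sum>i\<in>I. u i *s F $ \<rho> i) = (\<Sum>i\<in>I. u (inv_into I \<rho> (\<rho> i)) *s F $ \<rho> i)"
      by (rule sum.cong) (use \<rho> in \<open>auto simp: bij_betw_def inv_into_f_f\<close>)
    also have "\<dots> = (\<Sum>r\<in>UNIV. u (inv_into I \<rho> r) *s F $ r)" by (rule reindex)
    finally have zero: "(\<Sum>r\<in>UNIV. u (inv_into I \<rho> r) *s F $ r) = 0" .
    have "u (inv_into I \<rho> k) * det F = 0" for k
    proof -
      have "det (\<chi> i. if i = k then \<Sum>r\<in>UNIV. u (inv_into I \<rho> r) *s F $ r else F $ i) = 0"
        unfolding zero by (rule det_row_0)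
      then show ?thesis unfolding det_row_combination .
    qed
    then have "u (inv_into I \<rho> k) = 0" for k
      using \<open>det F \<noteq> 0\<close> by (simp add: coord_ring_mult_eq_0_iff)
    then show "\<forall>i\<in>I. u i = 0" using \<rho> by (metis bij_betw_inv_into_left)
  qed
  moreover have "op.span ((\<lambda>i. der (F $ \<rho> i)) ` I) = der ` log_vecs"
  proof
    have "op.subspace (der ` log_vecs)"
    proof -
      have "0 \<in> log_vecs" using log_vecs_sum[of "{}"] by simp
      moreover have "f + f' \<in> log_vecs" if "f \<in> log_vecs" "f' \<in> log_vecs" for f f'
        using that by (auto simp: log_vecs_def pair_add)
      ultimately show ?thesis
        using log_vecs_scale
        by (auto simp: op.subspace_def image_iff simp flip: der_add der_scale intro: bexI[of _ 0])
    qed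
    then show "op.span ((\<lambda>i. der (F $ \<rho> i)) ` I) \<subseteq> der ` log_vecs"
      by (intro op.span_minimal) (use F(1) in auto)
    show "der ` log_vecs \<subseteq> op.span ((\<lambda>i. der (F $ \<rho> i)) ` I)"
    proof
      fix \<theta> assume "\<theta> \<in> der ` log_vecs"
      then obtain f where f: "f \<in> log_vecs" "\<theta> = der f" by auto
      obtain y where "f = (\<Sum>r\<in>UNIV. y r *s F $ r)"
        using saito_span[OF F f(1)] by auto
      then have "\<theta> = (\<Sum>i\<in>I. y (\<rho> i) *\<^sub>S der (F $ \<rho> i))"
        using reindex[of "\<lambda>r. y r *s F $ r"] by (simp add: f(2) flip: der_sum der_scale)
      then show "\<theta> \<in> op.span ((\<lambda>i. der (F $ \<rho> i)) ` I)"
        by (auto intro!: op.span_sum op.span_scale intro: op.span_base)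
    qed
  qed
  ultimately show ?thesis by (simp add: basis_family_def)
qed

end

text \<open>Compare components of degree 1 in an expansion of the Euler derivation: rows of degree
  above 1 would need coefficients of negative degree, so only row \<open>i\<^sub>0\<close> remains,
  with a constant coefficient.\<close>

lemma (in linear_forms) euler_row_of_spanning:
  assumes span: "\<And>f. f \<in> log_vecs \<Longrightarrow> \<exists>y. f = (\<Sum>r\<in>UNIV. y r *s M $ r)"
    and hom: "\<And>r k. hdeg (M $ r $ k) (e r)" and e: "e i\<^sub>0 = 1" "\<And>r. r \<noteq> i\<^sub>0 \<Longrightarrow> 1 < e r"
  shows "\<exists>c. c \<noteq> 0 \<and> (\<chi> k. var k) = const_poly c *s M $ i\<^sub>0"
proof -
  have "(\<chi> k. var k) \<in> log_vecs"
    by (simp add: log_vecs_def pair_def lin_def)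
  then obtain y where y: "(\<chi> k. var k) = (\<Sum>r\<in>UNIV. y r *s M $ r)" using span by blast
  define c where "c = Poly_Mapping.lookup (hcomp 0 (y i\<^sub>0)) 0"
  have c: "hcomp 0 (y i\<^sub>0) = const_poly c"
    unfolding c_def by (rule hdeg_0_imp_const) (rule hdeg_hcomp)
  have var_eq: "var k = const_poly c * M $ i\<^sub>0 $ k" for k
  proof -
    have "var k = (\<Sum>r\<in>UNIV. M $ r $ k * y r)"
      using arg_cong[OF y, of "\<lambda>f. f $ k"] by (simp add: mult.commute)
    then have "hcomp 1 (var k) = (\<Sum>r\<in>UNIV. hcomp 1 (M $ r $ k * y r))"
      by (simp add: hcomp_sum)
    also have "hcomp 1 (var k) = (var k :: ('a, 'n) coord_ring)" by (rule hcomp_eq_self) simp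
    also have "(\<Sum>r\<in>UNIV. hcomp 1 (M $ r $ k * y r)) =
        (\<Sum>r\<in>UNIV. if r = i\<^sub>0 then const_poly c * M $ i\<^sub>0 $ k else 0)"
    proof (rule sum.cong)
      fix r
      have mult: "hcomp 1 (M $ r $ k * y r) = M $ r $ k * hcomp (1 - e r) (y r)"
        using hcomp_mult[OF hom, of "1 - e r" r k "y r"] by simp
      show "hcomp 1 (M $ r $ k * y r) = (if r = i\<^sub>0 then const_poly c * M $ i\<^sub>0 $ k else 0)"
      proof (cases "r = i\<^sub>0")
        case True
        then show ?thesis using mult e(1) c by (simp add: mult.commute)
      next
        case False
        then have "hcomp (1 - e r) (y r) = 0"
          using hdeg_nonneg[OF hdeg_hcomp, of "1 - e r" "y r"] e(2) by fastforce
        then show ?thesis using False mult by simp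
      qed
    qed simp
    finally show ?thesis by simp
  qed
  have "c \<noteq> 0"
  proof
    assume "c = 0"
    then have "lin (axis k (1::'a)) = 0" for k :: 'n using var_eq[of k] by (simp add: lin_axis)
    then show False by (simp add: axis_eq_0_iff)
  qed
  then show ?thesis using var_eq by (auto simp: vec_eq_iff)
qed

subsection \<open>Arrangements\<close>

lemma cdot_add_right: "cdot a (u + v) = cdot a u + cdot a v"
  and cdot_diff_right: "cdot a (u - v) = cdot a u - cdot a v"
  and cdot_scale_right: "cdot a (t *s v) = t * cdot a v"
  and cdot_zero_right [simp]: "cdot a 0 = 0"
  by (simp_all add: cdot_def algebra_simps sum.distrib sum_subtractf sum_distrib_left)

lemma dim_Int_kernel:
  assumes "vec.subspace U"
  shows "vec.dim U \<le> vec.dim (U \<inter> {v. cdot a v = 0}) + 1"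
proof (cases "U \<subseteq> {v. cdot a v = 0}")
  case True
  then show ?thesis by (simp add: Int_absorb2)
next
  case False
  let ?K = "U \<inter> {v. cdot a v = 0}"
  from False obtain u where u: "u \<in> U" "cdot a u \<noteq> 0" by auto
  have "U \<subseteq> vec.span (insert u ?K)"
  proof
    fix v assume v: "v \<in> U"
    let ?t = "cdot a v / cdot a u"
    have "v - ?t *s u \<in> ?K"
      using u v assms
      by (auto simp: cdot_diff_right cdot_scale_right intro: vec.subspace_diff vec.subspace_scale)
    then have "?t *s u + (v - ?t *s u) \<in> vec.span (insert u ?K)"
      by (intro vec.span_add vec.span_scale vec.span_base) auto
    then show "v \<in> vec.span (insert u ?K)" by simp
  qed
  then have "vec.dim U \<le> vec.dim (insert u ?K)"
    by (metis vec.dim_span vec.dim_subset)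
  also have "\<dots> \<le> vec.dim ?K + 1" by (simp add: vec.dim_insert)
  finally show ?thesis .
qed

text \<open>Each additional equation lowers the dimension by at most 1. This bounds from below the
  number of hyperplanes that cut out a space of given codimension.\<close>

lemma CARD_le_dim_common_kernel:
  fixes b :: "'h \<Rightarrow> 'a::field ^ 'n::finite"
  assumes "finite S"
  shows "CARD('n) \<le> vec.dim {v. \<forall>K\<in>S. cdot (b K) v = 0} + card S"
  using assms
proof (induction S rule: finite_induct)
  case empty
  then show ?case by (simp add: card_cart_basis)
next
  case (insert K S)
  let ?U = "{v. \<forall>L\<in>S. cdot (b L) v = 0}"
  have "vec.subspace ?U"
    by (auto simp: vec.subspace_def cdot_add_right cdot_scale_right)
  from dim_Int_kernel[OF this, of "b K"]
  have "vec.dim ?U \<le> vec.dim {v. \<forall>L\<in>insert K S. cdot (b L) v = 0} + 1"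
    by (simp add: Collect_conj_eq Int_commute)
  then show ?case using insert by simp
qed

lemma mem_hyperplane_iff:
  assumes "defining_forms \<A> \<alpha>" "H \<in> \<A>"
  shows "v \<in> H \<longleftrightarrow> cdot (coeffs (\<alpha> H)) v = 0"
proof -
  have \<alpha>: "\<alpha> H \<in> dual_space" "{v. \<alpha> H v = 0} = H"
    using assms by (auto simp: defining_forms_def ker_def)
  have "v \<in> H \<longleftrightarrow> \<alpha> H v = 0" using \<alpha>(2) by blast
  then show ?thesis by (simp add: dual_space_eq_cdot[OF \<alpha>(1)])
qed

lemma linear_forms_of_arrangement:
  assumes "arrangement \<A>" "defining_forms \<A> \<alpha>"
  shows "linear_forms \<A> (\<lambda>H. coeffs (\<alpha> H))"
proof
  show "finite \<A>" using assms(1) by (simp add: arrangement_def)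
  show nonzero: "coeffs (\<alpha> H) \<noteq> 0" if H: "H \<in> \<A>" for H
  proof
    assume "coeffs (\<alpha> H) = 0"
    then have "H = UNIV" using mem_hyperplane_iff[OF assms(2) H] by (auto simp: cdot_def)
    then show False using assms(1) H by (auto simp: arrangement_def codim_def card_cart_basis)
  qed
  fix H K assume HK: "H \<in> \<A>" "K \<in> \<A>" "H \<noteq> K"
  show "\<not> lin (coeffs (\<alpha> H)) dvd lin (coeffs (\<alpha> K))"
  proof
    assume "lin (coeffs (\<alpha> H)) dvd lin (coeffs (\<alpha> K))"
    then obtain s where s: "coeffs (\<alpha> K) = s *s coeffs (\<alpha> H)"
      using lin_dvd_lin_imp_scale nonzero[OF HK(1)] by blast
    then have "s \<noteq> 0" using nonzero[OF HK(2)] by auto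
    then have "v \<in> H \<longleftrightarrow> v \<in> K" for v
      using HK s by (simp add: mem_hyperplane_iff[OF assms(2)] cdot_scale)
    then show False using HK(3) by auto
  qed
qed

lemma log_der_eq:
  assumes "linear_forms \<A> (\<lambda>H. coeffs (\<alpha> H))"
  shows "log_der \<alpha> \<A> = der ` linear_forms.log_vecs \<A> (\<lambda>H. coeffs (\<alpha> H))"
  by (auto simp: log_der_def Der_eq_range_der linear_forms.log_vecs_def[OF assms] form_poly_eq_lin der_lin)

lemma basis_family_cong:
  assumes "\<And>i. i \<in> I \<Longrightarrow> \<theta> i = \<theta>' i"
  shows "basis_family I \<theta> M \<longleftrightarrow> basis_family I \<theta>' M"
  unfolding basis_family_def using assms by (simp cong: inj_on_cong image_cong)

text \<open>One hyperplane is chosen for each member of the restriction, so that a product over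
  \<open>C\<close> has exactly one factor per member.\<close>

lemma restriction_transversal:
  obtains C where "C \<subseteq> \<A> - {H}" "inj_on (\<lambda>K. H \<inter> K) C" "restriction \<A> H = (\<lambda>K. H \<inter> K) ` C"
proof -
  have "restriction \<A> H \<subseteq> (\<lambda>K. H \<inter> K) ` (\<A> - {H})" by (auto simp: restriction_def)
  then obtain C where "C \<subseteq> \<A> - {H}" "inj_on (\<lambda>K. H \<inter> K) C" "restriction \<A> H = (\<lambda>K. H \<inter> K) ` C"
    unfolding subset_image_inj by blast
  then show thesis by (rule that)
qed

theorem theorem1p3:
  fixes \<A> :: "('a::field ^ 'n::finite) set set"
    and \<alpha> :: "('a ^ 'n) set \<Rightarrow> 'a ^ 'n \<Rightarrow> 'a"
    and d :: "nat \<Rightarrow> nat" and q :: nat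
    and H :: "nat \<Rightarrow> ('a ^ 'n) set"
  defines "\<A>' \<equiv> \<A> - H ` {2..q}"
  assumes "arrangement \<A>"
    and "defining_forms \<A> \<alpha>"
    and "free_with_exponents \<alpha> \<A> (add_mset 1 (image_mset d (mset_set {2..CARD('n)})))"
    and "1 < d 2"
    and "mono_on {2..CARD('n)} d"
    and "2 \<le> q" and "q \<le> CARD('n)"
    and "\<forall>j\<in>{2..q}. H j \<in> \<A>"
    and "\<forall>j\<in>{2..q}. int (card \<A>) - int (card (restriction \<A> (H j))) = int (d j)"
    and "codim (\<Inter>i\<in>{2..q}. H i) = q - 1"
    and "\<not> (\<Inter>i\<in>{2..q}. H i) \<subseteq> \<Union> \<A>'"
  shows "free_with_exponents \<alpha> \<A>'
           (add_mset 1 (image_mset (\<lambda>i. d i - 1) (mset_set {2..q}) +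
                        image_mset d (mset_set {q + 1..CARD('n)})))
       \<and> (\<exists>\<eta> \<theta> :: nat \<Rightarrow> ('a, 'n) operator.
            basis_family {1..CARD('n)}
              (\<lambda>i. if i = 1 then euler
                   else if i \<le> q then form_poly (\<alpha> (H i)) *\<^sub>S \<eta> i
                   else \<theta> i)
              (log_der \<alpha> \<A>)
            \<and> (\<forall>i\<in>{2..q}. \<eta> i \<in> Der \<and> homogeneous_der (\<eta> i) (d i - 1))
            \<and> (\<forall>j\<in>{q + 1..CARD('n)}. \<theta> j \<in> Der \<and> homogeneous_der (\<theta> j) (d j)))"
proof -
  note arr = assms(2) and forms = assms(3) and d2 = assms(5) and q = assms(7,8)
  define l where "l = CARD('n)"
  define b where "b H = coeffs (\<alpha> H)" for H
  define I where "I = {1..l}"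
  have l: "2 \<le> q" "q \<le> l" "2 \<le> l" using q by (auto simp: l_def)
  have d_mono: "d i \<le> d j" if "2 \<le> i" "i \<le> j" "j \<le> l" for i j
    using assms(6) that by (auto simp: l_def mono_on_def)
  then have d_gt_1: "1 < d i" if "2 \<le> i" "i \<le> l" for i
    using d2 that less_le_trans by blast
  interpret linear_forms \<A> b
    unfolding b_def using arr forms by (rule linear_forms_of_arrangement)
  have mem: "v \<in> K \<longleftrightarrow> cdot (b K) v = 0" if "K \<in> \<A>" for K v
    using mem_hyperplane_iff[OF forms that] by (simp add: b_def)
  have log_der: "log_der \<alpha> \<A> = der ` log_vecs"
    using log_der_eq[of \<A> \<alpha>] linear_forms_axioms by (simp add: b_def[abs_def])

  \<comment> \<open>Exponents are numbered by \<open>{1..l}\<close>, while matrix rows are indexed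
    by \<open>'n\<close>; \<open>\<rho>\<close> and its inverse \<open>\<iota>\<close> translate,
    and \<open>i\<^sub>0\<close> is the row of exponent 1.\<close>
  obtain \<rho> :: "nat \<Rightarrow> 'n" where \<rho>: "bij_betw \<rho> I UNIV"
    using ex_bij_betw_nat_finite_1[of "UNIV :: 'n set"] by (auto simp: I_def l_def)
  define \<iota> where "\<iota> = inv_into I \<rho>"
  have \<iota>: "bij_betw \<iota> UNIV I" unfolding \<iota>_def by (rule bij_betw_inv_into[OF \<rho>])
  have \<iota>_\<rho>: "\<iota> (\<rho> i) = i" if "i \<in> I" for i
    using that \<rho> by (simp add: \<iota>_def bij_betw_inv_into_left)
  have \<rho>_\<iota>: "\<rho> (\<iota> r) = r" for r
    using \<rho> by (simp add: \<iota>_def bij_betw_inv_into_right)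
  have \<iota>_mem: "\<iota> r \<in> I" for r using \<iota> by (auto simp: bij_betw_def)
  define i\<^sub>0 where "i\<^sub>0 = \<rho> 1"
  define dd where "dd k = (if k = 1 then 1 else d k)" for k :: nat
  define e where "e r = int (dd (\<iota> r))" for r
  have \<iota>_eq_1: "\<iota> r = 1 \<longleftrightarrow> r = i\<^sub>0" for r
    using \<iota>_\<rho>[of 1] \<rho>_\<iota>[of r] l by (auto simp: i\<^sub>0_def I_def)
  have e_i\<^sub>0: "e i\<^sub>0 = 1" using \<iota>_eq_1[of i\<^sub>0] by (simp add: e_def dd_def)
  have e_gt_1: "1 < e r" if "r \<noteq> i\<^sub>0" for r
    using that \<iota>_eq_1[of r] \<iota>_mem[of r] d_gt_1[of "\<iota> r"] by (simp add: e_def dd_def I_def)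

  obtain \<theta>\<^sub>0 e\<^sub>0 where \<theta>\<^sub>0: "basis_family I \<theta>\<^sub>0 (log_der \<alpha> \<A>)"
    and hom_\<theta>\<^sub>0: "\<And>i. i \<in> I \<Longrightarrow> homogeneous_der (\<theta>\<^sub>0 i) (e\<^sub>0 i)"
    and e\<^sub>0: "add_mset 1 (image_mset d (mset_set {2..l})) = image_mset e\<^sub>0 (mset_set I)"
    using assms(4) unfolding free_with_exponents_def l_def I_def by blast
  have I_eq: "I = insert 1 {2..l}" using l by (auto simp: I_def)
  have "image_mset dd (mset_set I) = add_mset 1 (image_mset d (mset_set {2..l}))"
    unfolding I_eq by (simp add: dd_def) (rule image_mset_cong, simp add: dd_def)
  \<comment> \<open>The given basis may list its exponents in any order; equality of multisets
    yields a permutation \<open>p\<close> that arranges them as in \<open>dd\<close>.\<close>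
  then obtain p where p: "p permutes I" "\<forall>i\<in>I. dd i = e\<^sub>0 (p i)"
    using e\<^sub>0 image_mset_eq_implies_permutes[of I dd e\<^sub>0] by (auto simp: I_def)
  define t where "t i = (SOME f. der f = \<theta>\<^sub>0 i)" for i
  have t: "der (t i) = \<theta>\<^sub>0 i" if "i \<in> I" for i
  proof -
    have "\<theta>\<^sub>0 i \<in> log_der \<alpha> \<A>"
      using \<theta>\<^sub>0 that by (auto simp: basis_family_def intro: op.span_base)
    then show ?thesis unfolding t_def log_der by (auto intro: someI)
  qed
  have t_basis: "basis_family I (\<lambda>i. der (t i)) (der ` log_vecs)"
    using \<theta>\<^sub>0 t basis_family_cong[of I "\<lambda>i. der (t i)" \<theta>\<^sub>0] by (simp add: log_der)
  define T\<^sub>0 where "T\<^sub>0 = (\<chi> r. t (p (\<iota> r)))"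
  have p\<iota>: "bij_betw (\<lambda>r. p (\<iota> r)) UNIV I"
    using bij_betw_trans[OF \<iota> permutes_imp_bij[OF p(1)]] by (simp add: o_def)
  then have p\<iota>_mem: "p (\<iota> r) \<in> I" for r by (auto simp: bij_betw_def)
  have T\<^sub>0: "T\<^sub>0 $ r \<in> log_vecs" for r
    using spanning_of_basis_family(1)[OF t_basis _ p\<iota>_mem] by (simp add: T\<^sub>0_def I_def)
  have T\<^sub>0_span: "\<exists>y. f = (\<Sum>r\<in>UNIV. y r *s T\<^sub>0 $ r)" if f: "f \<in> log_vecs" for f
  proof -
    obtain u where "f = (\<Sum>i\<in>I. u i *s t i)"
      using spanning_of_basis_family(2)[OF t_basis _ f] by (auto simp: I_def)
    also have "\<dots> = (\<Sum>r\<in>UNIV. u (p (\<iota> r)) *s T\<^sub>0 $ r)"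
      using sum.reindex_bij_betw[OF p\<iota>, of "\<lambda>i. u i *s t i"] by (simp add: T\<^sub>0_def)
    finally show ?thesis by (rule exI[of _ "\<lambda>r. u (p (\<iota> r))"])
  qed
  have hom_T\<^sub>0: "hdeg (T\<^sub>0 $ r $ k) (e r)" for r k
    using hom_\<theta>\<^sub>0[OF p\<iota>_mem[of r]] p(2) \<iota>_mem[of r] t[OF p\<iota>_mem[of r], symmetric]
    by (simp add: T\<^sub>0_def e_def homogeneous_der_iff)
  obtain c\<^sub>0 where c\<^sub>0: "c\<^sub>0 \<noteq> 0" "det T\<^sub>0 = const_poly c\<^sub>0 * Q" and sum_e: "sum e UNIV = int (card \<A>)"
    using det_of_homogeneous_spanning[OF T\<^sub>0 T\<^sub>0_span hom_T\<^sub>0] by auto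
  obtain c\<^sub>1 where c\<^sub>1: "c\<^sub>1 \<noteq> 0" "(\<chi> k. var k) = const_poly c\<^sub>1 *s T\<^sub>0 $ i\<^sub>0"
    using euler_row_of_spanning[OF T\<^sub>0_span hom_T\<^sub>0 e_i\<^sub>0 e_gt_1] by auto
  \<comment> \<open>Rescaling by a nonzero constant turns row \<open>i\<^sub>0\<close> into the
    Euler derivation itself.\<close>
  define T where "T = (\<chi> r. if r = i\<^sub>0 then const_poly c\<^sub>1 *s T\<^sub>0 $ i\<^sub>0 else T\<^sub>0 $ r)"
  have T: "T $ r \<in> log_vecs" for r using T\<^sub>0 log_vecs_scale by (auto simp: T_def)
  have hom_T: "hdeg (T $ r $ k) (e r)" for r k
    using hom_T\<^sub>0 by (auto simp: T_def intro: hdeg_const_mult)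
  have T_i\<^sub>0: "T $ i\<^sub>0 = (\<chi> k. var k)" by (simp add: T_def c\<^sub>1(2))
  have "det T = const_poly c\<^sub>1 * det (\<chi> r. if r = i\<^sub>0 then T\<^sub>0 $ i\<^sub>0 else T\<^sub>0 $ r)"
    unfolding T_def by (rule det_row_mul)
  also have "(\<chi> r. if r = i\<^sub>0 then T\<^sub>0 $ i\<^sub>0 else T\<^sub>0 $ r) = T\<^sub>0" by (simp add: vec_eq_iff)
  finally have det_T: "det T = const_poly (c\<^sub>1 * c\<^sub>0) * Q" "c\<^sub>1 * c\<^sub>0 \<noteq> 0"
    using c\<^sub>0 c\<^sub>1(1) by (simp_all add: const_poly_mult mult.assoc)

  obtain x where x: "\<And>i. i \<in> {2..q} \<Longrightarrow> x \<in> H i" "\<And>K. K \<in> \<A>' \<Longrightarrow> x \<notin> K"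
    using assms(12) by blast
  have H_mem: "H ` {2..q} \<subseteq> \<A>" using assms(9) by auto
  have card_H: "card (H ` {2..q}) \<le> q - 1"
    using card_image_le[of "{2..q}" H] by simp
  \<comment> \<open>Fewer than \<open>q - 1\<close> hyperplanes cannot cut out a space of
    codimension \<open>q - 1\<close>. This gives the distinctness of the \<open>H i\<close> and,
    later, that none of them is redundant.\<close>
  have card_ge: "q - 1 \<le> card S" if S: "S \<subseteq> \<A>" "(\<Inter>i\<in>{2..q}. H i) = \<Inter>S" for S
  proof -
    have "finite S" using S(1) finite_A by (rule finite_subset)
    have "\<Inter>S = {v. \<forall>K\<in>S. cdot (b K) v = 0}" using mem S(1) by blast
    then have "CARD('n) \<le> vec.dim (\<Inter>i\<in>{2..q}. H i) + card S"
      using CARD_le_dim_common_kernel[OF \<open>finite S\<close>, of b] by (simp add: S(2))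
    then show ?thesis using assms(11) by (simp add: codim_def)
  qed
  have "card (H ` {2..q}) = q - 1"
    using card_ge[OF H_mem] card_H by simp
  then have inj_H: "inj_on H {2..q}" by (intro eq_card_imp_inj_on) auto
  \<comment> \<open>If \<open>x\<close> were 0, it would lie in every hyperplane, so
    \<open>\<A>'\<close> would be empty and \<open>\<A>\<close> would have at most
    \<open>l - 1\<close> members; but the \<open>l\<close> exponents, all at least 1, sum to
    \<open>card \<A>\<close>.\<close>
  have x_nonzero: "x \<noteq> 0"
  proof
    assume "x = 0"
    then have "K \<notin> \<A>'" for K
      using x(2)[of K] mem[of K] by (auto simp: assms(1))
    then have "\<A> = H ` {2..q}" using H_mem by (auto simp: assms(1))
    then have "sum e UNIV \<le> int l - 1" using sum_e card_H l by simp
    moreover have "(\<Sum>r\<in>(UNIV :: 'n set). 1) \<le> sum e UNIV"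
    proof (rule sum_mono)
      show "1 \<le> e r" for r using e_i\<^sub>0 e_gt_1[of r] by (cases "r = i\<^sub>0") auto
    qed
    ultimately show False by (simp add: l_def)
  qed

  define R where "R = \<rho> ` {2..q}"
  define h where "h r = H (\<iota> r)" for r
  have sub_I: "{2..q} \<subseteq> I" using l by (auto simp: I_def)
  have \<iota>_R: "\<iota> r \<in> {2..q}" if "r \<in> R" for r
    using that \<iota>_\<rho> sub_I by (auto simp: R_def)
  have R_iff: "r \<in> R \<longleftrightarrow> \<iota> r \<in> {2..q}" for r
    using \<iota>_R \<rho>_\<iota>[of r] unfolding R_def by (metis imageI)
  have h_R: "h ` R = H ` {2..q}"
    using \<iota>_\<rho> sub_I by (force simp: h_def R_def image_image)
  have inj_h: "inj_on h R"
  proof (rule inj_onI)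
    fix r s assume "r \<in> R" "s \<in> R" "h r = h s"
    then have "\<iota> r = \<iota> s" using inj_onD[OF inj_H] \<iota>_R by (auto simp: h_def)
    then show "r = s" by (metis \<rho>_\<iota>)
  qed
  have relations: "\<exists>g \<eta>. (\<forall>i. hdeg (g i) (e r - e i)) \<and>
      (\<Sum>i\<in>UNIV. g i *s T $ i) = lin (b (h r)) *s \<eta> \<and> eval_at x (pair (b (h r)) \<eta>) \<noteq> 0"
    if r: "r \<in> R" for r
  proof -
    have hr: "h r \<in> \<A>" "x \<in> h r" using h_R H_mem r \<iota>_R x(1) by (auto simp: h_def)
    obtain C where C: "C \<subseteq> \<A> - {h r}" "inj_on (\<lambda>K. h r \<inter> K) C"
      "restriction \<A> (h r) = (\<lambda>K. h r \<inter> K) ` C"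
      by (rule restriction_transversal)
    have "int (card \<A>) - int (card C) = e r"
    proof -
      have "card (restriction \<A> (h r)) = card C" by (simp add: C(3) card_image[OF C(2)])
      moreover have "int (card \<A>) - int (card (restriction \<A> (h r))) = int (d (\<iota> r))"
        using assms(10) \<iota>_R[OF r] by (simp add: h_def)
      ultimately show ?thesis using \<iota>_R[OF r] by (simp add: e_def dd_def)
    qed
    moreover have "\<exists>g \<eta>. (\<forall>i. hdeg (g i) (int (card \<A>) - int (card C) - e i)) \<and>
      (\<Sum>i\<in>UNIV. g i *s T $ i) = lin (b (h r)) *s \<eta> \<and> eval_at x (pair (b (h r)) \<eta>) \<noteq> 0"
    proof (rule relation_modulo_form[OF hr(1) T det_T hom_T sum_e C(1)])
      fix K L s s' assume KL: "K \<in> C" "L \<in> C" "K \<noteq> L"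
      then have A: "K \<in> \<A>" "L \<in> \<A>" "L \<noteq> h r" using C(1) by auto
      show "b L \<noteq> s *s b K + s' *s b (h r)"
      proof
        assume eq: "b L = s *s b K + s' *s b (h r)"
        have "s \<noteq> 0"
        proof
          assume "s = 0"
          then have "lin (b (h r)) dvd lin (b L)" using eq by (simp add: lin_scale)
          then show False using not_dvd[OF hr(1) A(2)] A(3) by auto
        qed
        then have "h r \<inter> K = h r \<inter> L"
          using mem[OF hr(1)] mem[OF A(1)] mem[OF A(2)] eq
          by (auto simp: cdot_add cdot_scale)
        then show False using inj_onD[OF C(2)] KL by blast
      qed
    next
      show "cdot (b (h r)) x = 0" using hr mem by simp
    next
      fix K assume K: "K \<in> \<A> - {h r} - C"
      show "cdot (b K) x \<noteq> 0"
      proof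
        \<comment> \<open>A hyperplane \<open>K\<close> through \<open>x\<close> is one of the
          \<open>H i\<close>, and so is the \<open>L\<close> chosen with the same trace on
          \<open>h r\<close>. Then \<open>K\<close> could be omitted from the intersection, against
          \<open>card_ge\<close>.\<close>
        assume "cdot (b K) x = 0"
        then have "x \<in> K" using mem K by simp
        then have K_H: "K \<in> H ` {2..q}" using x(2)[of K] K by (auto simp: assms(1))
        have "h r \<inter> K \<in> restriction \<A> (h r)" using K by (auto simp: restriction_def)
        then obtain L where L: "L \<in> C" "h r \<inter> K = h r \<inter> L" by (auto simp: C(3))
        then have "x \<in> L" using \<open>x \<in> K\<close> hr(2) by auto
        then have "L \<in> H ` {2..q}" using x(2)[of L] L(1) C(1) by (auto simp: assms(1))
        moreover have "L \<noteq> K" using L(1) K by auto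
        moreover have "h r \<in> H ` {2..q}" "h r \<noteq> K" using h_R r K by auto
        ultimately have "\<Inter>(H ` {2..q}) = \<Inter>(H ` {2..q} - {K})" using L(2) by blast
        then have "q - 1 \<le> card (H ` {2..q} - {K})"
          using H_mem by (intro card_ge) auto
        then show False using K_H card_H l by (simp add: card_Diff_singleton)
      qed
    qed
    ultimately show ?thesis by simp
  qed
  then have "\<forall>r\<in>R. \<exists>g \<eta>. (\<forall>i. hdeg (g i) (e r - e i)) \<and>
      (\<Sum>i\<in>UNIV. g i *s T $ i) = lin (b (h r)) *s \<eta> \<and> eval_at x (pair (b (h r)) \<eta>) \<noteq> 0"
    by blast
  from bchoice[OF this] obtain g where "\<forall>r\<in>R. \<exists>\<eta>. (\<forall>i. hdeg (g r i) (e r - e i)) \<and>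
      (\<Sum>i\<in>UNIV. g r i *s T $ i) = lin (b (h r)) *s \<eta> \<and> eval_at x (pair (b (h r)) \<eta>) \<noteq> 0"
    by (rule exE)
  from bchoice[OF this] obtain \<eta> where "\<forall>r\<in>R. (\<forall>i. hdeg (g r i) (e r - e i)) \<and>
      (\<Sum>i\<in>UNIV. g r i *s T $ i) = lin (b (h r)) *s \<eta> r \<and> eval_at x (pair (b (h r)) (\<eta> r)) \<noteq> 0"
    by (rule exE)
  then have g: "(\<forall>i. hdeg (g r i) (e r - e i)) \<and>
      (\<Sum>i\<in>UNIV. g r i *s T $ i) = lin (b (h r)) *s \<eta> r \<and> eval_at x (pair (b (h r)) (\<eta> r)) \<noteq> 0"
    if "r \<in> R" for r
    using that by blast
  interpret simultaneous_relations \<A> b T "c\<^sub>1 * c\<^sub>0" e i\<^sub>0 R h g \<eta> x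
  proof
    show "h ` R \<subseteq> \<A>" using h_R H_mem by simp
    show "cdot (b (h r)) x = 0" if "r \<in> R" for r
    proof -
      have "h r \<in> \<A>" "x \<in> h r" using h_R H_mem that \<iota>_R x(1) by (auto simp: h_def)
      then show ?thesis using mem by simp
    qed
    show "i\<^sub>0 \<notin> R" using R_iff[of i\<^sub>0] \<iota>_eq_1[of i\<^sub>0] by simp
    show "e i \<le> e j" if "i \<in> R" "j \<notin> R" "j \<noteq> i\<^sub>0" for i j
    proof -
      have "2 \<le> \<iota> i" "\<iota> i \<le> \<iota> j" "\<iota> j \<le> l" "\<iota> j \<noteq> 1"
        using that R_iff[of i] R_iff[of j] \<iota>_eq_1[of j] \<iota>_mem[of j] by (auto simp: I_def)
      then show ?thesis using d_mono by (simp add: e_def dd_def)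
    qed
  qed (use T det_T T_i\<^sub>0 inj_h x_nonzero g in auto)
  obtain \<tau> F c where c: "c \<noteq> 0" and F: "det F = const_poly c * Q" "\<And>r. F $ r \<in> log_vecs"
    "F $ i\<^sub>0 = (\<chi> k. var k)" "\<And>r. r \<in> R \<Longrightarrow> F $ r = lin (b (h r)) *s \<eta> r"
    "\<And>r. r \<notin> R \<Longrightarrow> r \<noteq> i\<^sub>0 \<Longrightarrow> F $ r = T $ \<tau> r \<and> e (\<tau> r) = e r"
    by (rule new_basis) blast
  define F' where "F' = (\<chi> r. if r \<in> R then \<eta> r else F $ r)"
  interpret deletion: linear_forms \<A>' b
    using linear_forms_deletion by (simp add: assms(1) h_R)
  have F': "F' $ r \<in> deletion.log_vecs" "det F' = const_poly c * deletion.Q" for r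
    using deletion_rows[OF F(2,4,1)] by (simp_all add: F'_def assms(1) h_R)
  have log_der': "log_der \<alpha> \<A>' = der ` deletion.log_vecs"
    using log_der_eq[of \<A>' \<alpha>] deletion.linear_forms_axioms by (simp add: b_def[abs_def])
  have \<rho>_R: "\<rho> i \<in> R \<longleftrightarrow> i \<in> {2..q}" if "i \<in> I" for i
    using R_iff[of "\<rho> i"] \<iota>_\<rho>[OF that] by simp
  have hom_\<eta>: "homogeneous_der (der (\<eta> (\<rho> i))) (d i - 1)" if i: "i \<in> {2..q}" for i
    unfolding homogeneous_der_iff
  proof
    fix k
    have iI: "i \<in> I" and r: "\<rho> i \<in> R" using i sub_I \<rho>_R by auto
    have "hdeg ((\<Sum>j\<in>UNIV. g (\<rho> i) j *s T $ j) $ k) (e (\<rho> i))"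
    proof -
      have "hdeg (g (\<rho> i) j * T $ j $ k) (e (\<rho> i))" for j
        using hdeg_mult[OF _ hom_T[of j k], of "g (\<rho> i) j" "e (\<rho> i) - e j"] g[OF r] by simp
      then show ?thesis by (simp add: hdeg_sum)
    qed
    then have "hdeg (lin (b (h (\<rho> i))) * \<eta> (\<rho> i) $ k) (e (\<rho> i))" using g[OF r] by simp
    then have "hdeg (\<eta> (\<rho> i) $ k) (e (\<rho> i) - 1)"
      by (rule hdeg_mult_cancel) (use nonzero h(2) r in auto)
    moreover have "e (\<rho> i) - 1 = int (d i - 1)"
      using i d_gt_1[of i] l by (auto simp: e_def dd_def \<iota>_\<rho>[OF iI])
    ultimately show "hdeg (\<eta> (\<rho> i) $ k) (int (d i - 1))" by simp
  qed
  have hom_F: "homogeneous_der (der (F $ \<rho> j)) (d j)" if j: "j \<in> {q + 1..l}" for j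
    unfolding homogeneous_der_iff
  proof
    fix k
    have jI: "j \<in> I" using j l by (auto simp: I_def)
    then have "\<rho> j \<notin> R" "\<rho> j \<noteq> i\<^sub>0"
      using \<rho>_R[OF jI] j l \<iota>_eq_1[of "\<rho> j"] \<iota>_\<rho>[OF jI] by auto
    \<comment> \<open>Row \<open>\<rho> j\<close> may come from another row of \<open>T\<close>, but
      from one with the same exponent.\<close>
    then have "F $ \<rho> j = T $ \<tau> (\<rho> j)" "e (\<tau> (\<rho> j)) = int (d j)"
      using F(5)[of "\<rho> j"] \<iota>_\<rho>[OF jI] j l by (auto simp: e_def dd_def)
    then show "hdeg (F $ \<rho> j $ k) (int (d j))" using hom_T[of "\<tau> (\<rho> j)" k] by simp
  qed
  define e' where "e' i = (if i = 1 then 1 else if i \<le> q then d i - 1 else d i)" for i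
  have "free_with_exponents \<alpha> \<A>'
      (add_mset 1 (image_mset (\<lambda>i. d i - 1) (mset_set {2..q}) + image_mset d (mset_set {q + 1..CARD('n)})))"
    unfolding free_with_exponents_def
  proof (intro exI[of _ "\<lambda>i. der (F' $ \<rho> i)"] exI[of _ e'] conjI ballI)
    show "basis_family {1..CARD('n)} (\<lambda>i. der (F' $ \<rho> i)) (log_der \<alpha> \<A>')"
      using deletion.basis_family_of_det[OF \<rho> F' c] by (simp add: log_der' I_def l_def)
    fix i assume "i \<in> {1..CARD('n)}"
    then have i: "i \<in> I" by (simp add: I_def l_def)
    consider "i = 1" | "i \<in> {2..q}" | "i \<in> {q + 1..l}"
      using i by (cases "i = 1"; cases "i \<le> q") (auto simp: I_def)
    then show "homogeneous_der (der (F' $ \<rho> i)) (e' i)"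
    proof cases
      case 1
      then have "F' $ \<rho> i = (\<chi> k. var k)" using i\<^sub>0_notin F(3) by (simp add: F'_def i\<^sub>0_def)
      then show ?thesis using 1 by (simp add: homogeneous_der_iff e'_def)
    next
      case 2
      then show ?thesis using hom_\<eta>[OF 2] \<rho>_R[OF i] by (simp add: F'_def e'_def)
    next
      case 3
      then show ?thesis using hom_F[OF 3] \<rho>_R[OF i] l by (simp add: F'_def e'_def)
    qed
  next
    have split: "{1..CARD('n)} = insert 1 ({2..q} \<union> {q + 1..l})" using l by (auto simp: l_def)
    have "image_mset e' (mset_set {1..CARD('n)}) =
        add_mset 1 (image_mset e' (mset_set {2..q}) + image_mset e' (mset_set {q + 1..l}))"
      unfolding split using l by (subst mset_set.insert) (auto simp: mset_set_Union e'_def)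
    also have "image_mset e' (mset_set {2..q}) = image_mset (\<lambda>i. d i - 1) (mset_set {2..q})"
      by (rule image_mset_cong) (simp add: e'_def)
    also have "image_mset e' (mset_set {q + 1..l}) = image_mset d (mset_set {q + 1..l})"
      using l by (intro image_mset_cong) (simp add: e'_def)
    finally show "add_mset 1 (image_mset (\<lambda>i. d i - 1) (mset_set {2..q}) +
        image_mset d (mset_set {q + 1..CARD('n)})) = image_mset e' (mset_set {1..CARD('n)})"
      by (simp add: l_def)
  qed
  moreover have "basis_family {1..CARD('n)} (\<lambda>i. if i = 1 then euler
      else if i \<le> q then form_poly (\<alpha> (H i)) *\<^sub>S der (\<eta> (\<rho> i)) else der (F $ \<rho> i)) (log_der \<alpha> \<A>)"
  proof -
    have "basis_family I (\<lambda>i. der (F $ \<rho> i)) (log_der \<alpha> \<A>)"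
      using basis_family_of_det[OF \<rho> F(2,1) c] by (simp add: log_der)
    also have "basis_family I (\<lambda>i. der (F $ \<rho> i)) (log_der \<alpha> \<A>) \<longleftrightarrow>
        basis_family I (\<lambda>i. if i = 1 then euler
          else if i \<le> q then form_poly (\<alpha> (H i)) *\<^sub>S der (\<eta> (\<rho> i)) else der (F $ \<rho> i)) (log_der \<alpha> \<A>)"
    proof (rule basis_family_cong)
      fix i assume i: "i \<in> I"
      have "der (F $ \<rho> i) = form_poly (\<alpha> (H i)) *\<^sub>S der (\<eta> (\<rho> i))" if "i \<noteq> 1" "i \<le> q"
        using that i F(4)[of "\<rho> i"] \<rho>_R[OF i] \<iota>_\<rho>[OF i]
        by (auto simp: form_poly_eq_lin b_def h_def der_scale I_def)
      then show "der (F $ \<rho> i) = (if i = 1 then euler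
          else if i \<le> q then form_poly (\<alpha> (H i)) *\<^sub>S der (\<eta> (\<rho> i)) else der (F $ \<rho> i))"
        using F(3) by (auto simp: euler_eq_der i\<^sub>0_def)
    qed
    finally show ?thesis by (simp add: I_def l_def)
  qed
  ultimately show ?thesis
    using hom_\<eta> hom_F
    by (intro conjI exI[of _ "\<lambda>i. der (\<eta> (\<rho> i))"] exI[of _ "\<lambda>i. der (F $ \<rho> i)"])
      (auto simp: Der_eq_range_der l_def)
qed

end
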